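(* For any $\mathbf{w}_0,\mathbf{w}_1\in\mathbb{R}^D$ it holds that $$d_{f^*H}(\mathbf{w}_0,\mathbf{w}_1)=0\quad\Longleftrightarrow\quad[\mathbf{w}_0]=[\mathbf{w}_1]\in\mathcal{P},$$ where $d_{f^*H}$ is the geodesic pseudo-distance on $\mathbb{R}^D$ induced by the pullback pseudo-metric $\mathrm{GGN}_{\mathbf{w}}$ and $\mathcal{P}=\mathbb{R}^D/\!\sim$ is the quotient of the parameter space by smooth reparameterization on the training set $\mathcal{X}$.
   Context: Setting. Let $f:\mathbb{R}^D\times\mathbb{R}^I\to\mathbb{R}^O$, $(\mathbf{w},\mathbf{x})\mapsto f(\mathbf{w},\mathbf{x})$, be a function (neural network) continuously differentiable in $\mathbf{w}$, and let $\mathcal{X}=\{\mathbf{x}_1,\ldots,\mathbf{x}_N\}\subset\mathbb{R}^I$ be a finite set of points. Let $\mathbf{J}_{\mathbf{w}}(\mathbf{x})=\partial_{\mathbf{w}}f(\mathbf{w},\mathbf{x})\in\mathbb{R}^{O\times D}$ and let $\mathbf{J}_{\mathbf{w}}\in\mathbb{R}^{NO\times D}$ be the vertical stacking of $\mathbf{J}_{\mathbf{w}}(\mathbf{x}_1),\ldots,\mathbf{J}_{\mathbf{w}}(\mathbf{x}_N)$. Let $p(\mathbf{y}\mid\mathbf{z})$, $\mathbf{z}\in\mathbb{R}^O$, be a likelihood whose negative log-Hessian $-\partial^2_{\mathbf{z}}\log p(\mathbf{y}\mid\mathbf{z})\in\mathbb{R}^{O\times O}$ does not depend on $\mathbf{y}$,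 is continuous in $\mathbf{z}$, and is positive definite. Let $\mathbf{H}_{\mathbf{w}}(\mathbf{x})$ be this matrix evaluated at $\mathbf{z}=f(\mathbf{w},\mathbf{x})$, and let $\mathbf{H}_{\mathbf{w}}\in\mathbb{R}^{NO\times NO}$ be the block-diagonal matrix with blocks $\mathbf{H}_{\mathbf{w}}(\mathbf{x}_1),\ldots,\mathbf{H}_{\mathbf{w}}(\mathbf{x}_N)$. Define $\mathrm{GGN}_{\mathbf{w}}=\mathbf{J}_{\mathbf{w}}^\top\mathbf{H}_{\mathbf{w}}\mathbf{J}_{\mathbf{w}}\in\mathbb{R}^{D\times D}$ and $\mathrm{NTK}_{\mathbf{w}}=\mathbf{H}_{\mathbf{w}}^{1/2}\mathbf{J}_{\mathbf{w}}\mathbf{J}_{\mathbf{w}}^\top\mathbf{H}_{\mathbf{w}}^{1/2}\in\mathbb{R}^{NO\times NO}$. Standing assumptions. There are constants $0<l\le L$ such that $l\le\|\mathrm{NTK}_{\mathbf{w}}v\|/\|v\|\le L$ for all nonzero $v\in\mathbb{R}^{NO}$ and all $\mathbf{w}\in\mathbb{R}^D$; and for every $\mathbf{x}\in\mathcal{X}$ the map $\mathbf{w}\mapsto\mathbf{J}_{\mathbf{w}}(\mathbf{x})$ is Lipschitz. Pseudo-distance. The pullback pseudo-metric at $\mathbf{w}$ is $(f^*H)_{\mathbf{w}}=\mathrm{GGN}_{\mathbf{w}}$, and $$d_{f^*H}(\mathbf{w}_0,\mathbf{w}_1)=\inf_\gamma\int_0^1\sqrt{\gamma'(t)^\top\,\mathrm{GGN}_{\gamma(t)}\,\gamma'(t)}\,dt,$$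 the infimum being over smoothly (continuously) differentiable curves $\gamma:[0,1]\to\mathbb{R}^D$ with $\gamma(0)=\mathbf{w}_0$, $\gamma(1)=\mathbf{w}_1$. Quotient. Write $\mathbf{w}\sim\mathbf{w}'$ if there is a continuous, piecewise differentiable $\gamma:[0,1]\to\mathbb{R}^D$ with $\gamma(0)=\mathbf{w}$, $\gamma(1)=\mathbf{w}'$ and $f(\gamma(t),\mathbf{x})=f(\mathbf{w},\mathbf{x})$ for all $t\in[0,1]$ and $\mathbf{x}\in\mathcal{X}$. This is an equivalence relation; $[\mathbf{w}]$ denotes the class of $\mathbf{w}$ and $\mathcal{P}=\mathbb{R}^D/\!\sim$. *)

theory Defs
  imports "HOL-Analysis.Analysis"
begin

section \<open>Matrices\<close>

definition pos_semidef :: "real^'n^'n \<Rightarrow> bool" where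
  "pos_semidef A \<longleftrightarrow> transpose A = A \<and> (\<forall>v. 0 \<le> v \<bullet> (A *v v))"

definition pos_def :: "real^'n^'n \<Rightarrow> bool" where
  "pos_def A \<longleftrightarrow> transpose A = A \<and> (\<forall>v. v \<noteq> 0 \<longrightarrow> 0 < v \<bullet> (A *v v))"

text \<open>The principal square root; it exists and is unique for positive semidefinite
  \<open>A\<close>, and is unspecified for other matrices.\<close>

definition matrix_sqrt :: "real^'n^'n \<Rightarrow> real^'n^'n" where
  "matrix_sqrt A = (THE B. pos_semidef B \<and> B ** B = A)"


section \<open>Hessians and likelihoods\<close>

definition gradient :: "(real^'n \<Rightarrow> real) \<Rightarrow> real^'n \<Rightarrow> real^'n" where
  "gradient g z = (\<chi> i. frechet_derivative g (at z) (axis i 1))"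

definition hessian :: "(real^'n \<Rightarrow> real) \<Rightarrow> real^'n \<Rightarrow> real^'n^'n" where
  "hessian g z = jacobian (gradient g) (at z)"

definition twice_differentiable :: "(real^'n \<Rightarrow> real) \<Rightarrow> bool" where
  "twice_differentiable g \<longleftrightarrow>
     (\<forall>z. g differentiable (at z)) \<and> (\<forall>z. gradient g differentiable (at z))"

text \<open>\<open>p y z\<close> stands for \<open>p(y | z)\<close>, a density in \<open>y\<close> with respect to the base measure \<open>M\<close>
  (counting measure for discrete observations, Lebesgue measure for continuous ones).
  It is positive on \<open>space M\<close> so that \<open>log p(y | z)\<close> is meaningful: observations outside
  a smaller common support are excluded by the choice of \<open>M\<close>.\<close>

definition likelihood :: "'y measure \<Rightarrow> ('y \<Rightarrow> real^'o \<Rightarrow> real) \<Rightarrow> bool" where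
  "likelihood M p \<longleftrightarrow>
     (\<forall>z. (\<lambda>y. p y z) \<in> borel_measurable M
        \<and> (\<forall>y\<in>space M. 0 < p y z)
        \<and> (\<integral>\<^sup>+ y. ennreal (p y z) \<partial>M) = 1)"


section \<open>Stacked Jacobian, GGN and NTK matrices\<close>

text \<open>The points of the training set are \<open>xs n\<close>, with \<open>n\<close> in the finite index type
  \<open>'n\<close>. Row \<open>(n, o)\<close> of a stacked matrix is row \<open>o\<close> of its \<open>n\<close>-th block, so that
  \<open>'n \<times> 'o\<close> plays the role of \<open>{1, \<dots>, NO}\<close>.\<close>

definition param_jacobian ::
    "(real^'d \<Rightarrow> real^'i \<Rightarrow> real^'o) \<Rightarrow> real^'d \<Rightarrow> real^'i \<Rightarrow> real^'d^'o" where
  "param_jacobian f w x = jacobian (\<lambda>w. f w x) (at w)"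

definition stacked_jacobian ::
    "(real^'d \<Rightarrow> real^'i \<Rightarrow> real^'o) \<Rightarrow> ('n::finite \<Rightarrow> real^'i) \<Rightarrow> real^'d \<Rightarrow>
     real^'d^('n \<times> 'o)" where
  "stacked_jacobian f xs w = (\<chi> r. param_jacobian f w (xs (fst r)) $ snd r)"

text \<open>In the remaining definitions \<open>H z\<close> is the negative log-Hessian of the likelihood
  at \<open>z\<close>, which does not depend on the observation.\<close>

definition stacked_hessian ::
    "(real^'o \<Rightarrow> real^'o^'o) \<Rightarrow> (real^'d \<Rightarrow> real^'i \<Rightarrow> real^'o) \<Rightarrow>
     ('n::finite \<Rightarrow> real^'i) \<Rightarrow> real^'d \<Rightarrow> real^('n \<times> 'o)^('n \<times> 'o)" where
  "stacked_hessian H f xs w =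
     (\<chi> r s. if fst r = fst s then H (f w (xs (fst r))) $ snd r $ snd s else 0)"

definition GGN ::
    "(real^'o \<Rightarrow> real^'o^'o) \<Rightarrow> (real^'d \<Rightarrow> real^'i \<Rightarrow> real^'o) \<Rightarrow>
     ('n::finite \<Rightarrow> real^'i) \<Rightarrow> real^'d \<Rightarrow> real^'d^'d" where
  "GGN H f xs w =
     transpose (stacked_jacobian f xs w) ** stacked_hessian H f xs w ** stacked_jacobian f xs w"

definition NTK ::
    "(real^'o \<Rightarrow> real^'o^'o) \<Rightarrow> (real^'d \<Rightarrow> real^'i \<Rightarrow> real^'o) \<Rightarrow>
     ('n::finite \<Rightarrow> real^'i) \<Rightarrow> real^'d \<Rightarrow> real^('n \<times> 'o)^('n \<times> 'o)" where
  "NTK H f xs w =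
     matrix_sqrt (stacked_hessian H f xs w) ** stacked_jacobian f xs w **
     transpose (stacked_jacobian f xs w) ** matrix_sqrt (stacked_hessian H f xs w)"


section \<open>Geodesic pseudo-distance\<close>

text \<open>Only the restriction of a curve to \<open>{0..1}\<close> matters; derivatives at the endpoints are
  one-sided.\<close>

definition C1_curve :: "(real \<Rightarrow> real^'d) \<Rightarrow> bool" where
  "C1_curve \<gamma> \<longleftrightarrow>
     (\<forall>t\<in>{0..1}. \<gamma> differentiable (at t within {0..1})) \<and>
     continuous_on {0..1} (\<lambda>t. vector_derivative \<gamma> (at t within {0..1}))"

definition curve_length :: "(real^'d \<Rightarrow> real^'d^'d) \<Rightarrow> (real \<Rightarrow> real^'d) \<Rightarrow> real" where
  "curve_length G \<gamma> =
     integral {0..1} (\<lambda>t. sqrt (vector_derivative \<gamma> (at t within {0..1}) \<bullet>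
                                (G (\<gamma> t) *v vector_derivative \<gamma> (at t within {0..1}))))"

definition geodesic_dist ::
    "(real^'d \<Rightarrow> real^'d^'d) \<Rightarrow> real^'d \<Rightarrow> real^'d \<Rightarrow> real" where
  "geodesic_dist G w0 w1 =
     Inf {curve_length G \<gamma> | \<gamma>. C1_curve \<gamma> \<and> \<gamma> 0 = w0 \<and> \<gamma> 1 = w1}"


section \<open>The quotient of the parameter space\<close>

definition reparam_rel ::
    "(real^'d \<Rightarrow> real^'i \<Rightarrow> real^'o) \<Rightarrow> (real^'i) set \<Rightarrow> ((real^'d) \<times> (real^'d)) set" where
  "reparam_rel f X =
     {(w, w'). \<exists>\<gamma> :: real \<Rightarrow> real^'d.
       \<gamma> piecewise_differentiable_on {0..1} \<and> \<gamma> 0 = w \<and> \<gamma> 1 = w' \<and>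
       (\<forall>t\<in>{0..1}. \<forall>x\<in>X. f (\<gamma> t) x = f w x)}"

lemma reparam_relI:
  fixes \<gamma> :: "real \<Rightarrow> real^'d"
  assumes "\<gamma> piecewise_differentiable_on {0..1}" "\<gamma> 0 = w" "\<gamma> 1 = w'"
    and "\<And>t x. t \<in> {0..1} \<Longrightarrow> x \<in> X \<Longrightarrow> f (\<gamma> t) x = f w x"
  shows "(w, w') \<in> reparam_rel f X"
  using assms unfolding reparam_rel_def by blast

lemma equiv_reparam_rel:
  fixes f :: "real^'d \<Rightarrow> real^'i \<Rightarrow> real^'o"
  shows "equiv UNIV (reparam_rel f X)"
proof (rule equivI)
  show "refl (reparam_rel f X)"
  proof (rule refl_onI)
    fix w :: "real^'d"
    show "(w, w) \<in> reparam_rel f X"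
      by (rule reparam_relI[of "\<lambda>_. w"]) auto
  qed
next
  show "sym (reparam_rel f X)"
  proof (rule symI)
    fix w w' assume "(w, w') \<in> reparam_rel f X"
    then obtain \<gamma> :: "real \<Rightarrow> real^'d"
      where \<gamma>: "\<gamma> piecewise_differentiable_on {0..1}" "\<gamma> 0 = w" "\<gamma> 1 = w'"
      and c: "\<forall>t\<in>{0..1}. \<forall>x\<in>X. f (\<gamma> t) x = f w x"
      unfolding reparam_rel_def by blast
    have img: "(\<lambda>t::real. (-1) *\<^sub>R t + 1) ` {0..1} = {0..1}"
      using image_affinity_atLeastAtMost[of "-1::real" 1 0 1] by simp
    show "(w', w) \<in> reparam_rel f X"
    proof (rule reparam_relI)
      show "(\<gamma> \<circ> (\<lambda>t. (-1) *\<^sub>R t + 1)) piecewise_differentiable_on {0..1}"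
        by (rule piecewise_differentiable_affine) (simp only: img \<gamma>(1))
      fix t :: real and x assume "t \<in> {0..1}" "x \<in> X"
      then show "f ((\<gamma> \<circ> (\<lambda>t. (-1) *\<^sub>R t + 1)) t) x = f w' x"
        using c[rule_format, of "1 - t" x] c[rule_format, of 1 x] \<gamma>(3) by simp
    qed (simp_all add: \<gamma>)
  qed
next
  show "trans (reparam_rel f X)"
  proof (rule transI)
    fix u v w assume uv: "(u, v) \<in> reparam_rel f X" and vw: "(v, w) \<in> reparam_rel f X"
    from uv obtain g :: "real \<Rightarrow> real^'d"
      where g: "g piecewise_differentiable_on {0..1}" "g 0 = u" "g 1 = v"
      and cg: "\<forall>t\<in>{0..1}. \<forall>x\<in>X. f (g t) x = f u x"
      unfolding reparam_rel_def by blast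
    from vw obtain h :: "real \<Rightarrow> real^'d"
      where h: "h piecewise_differentiable_on {0..1}" "h 0 = v" "h 1 = w"
      and ch: "\<forall>t\<in>{0..1}. \<forall>x\<in>X. f (h t) x = f v x"
      unfolding reparam_rel_def by blast
    define k where "k = (\<lambda>t. if t \<le> 1/2 then (g \<circ> (\<lambda>t. 2 *\<^sub>R t + 0)) t
                             else (h \<circ> (\<lambda>t. 2 *\<^sub>R t + (-1))) t)"
    have img: "(\<lambda>t::real. 2 *\<^sub>R t + 0) ` {0..1/2} = {0..1}"
      "(\<lambda>t::real. 2 *\<^sub>R t + (-1)) ` {1/2..1} = {0..1}"
      using image_affinity_atLeastAtMost[of "2::real" 0 0 "1/2"]
        image_affinity_atLeastAtMost[of "2::real" "-1" "1/2" 1] by simp_all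
    show "(u, w) \<in> reparam_rel f X"
    proof (rule reparam_relI)
      show "k piecewise_differentiable_on {0..1}"
        unfolding k_def
      proof (rule piecewise_differentiable_cases)
        show "(g \<circ> (\<lambda>t. 2 *\<^sub>R t + 0)) piecewise_differentiable_on {0..1/2}"
          by (rule piecewise_differentiable_affine) (simp only: img g(1))
        show "(h \<circ> (\<lambda>t. 2 *\<^sub>R t + (-1))) piecewise_differentiable_on {1/2..1}"
          by (rule piecewise_differentiable_affine) (simp only: img h(1))
      qed (simp_all add: g h)
      show "k 0 = u" "k 1 = w"
        by (simp_all add: k_def g h)
      fix t :: real and x assume t: "t \<in> {0..1}" and x: "x \<in> X"
      show "f (k t) x = f u x"
      proof (cases "t \<le> 1/2")
        case True
        then show ?thesis using cg[rule_format, of "2 * t" x] t x by (simp add: k_def)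
      next
        case False
        then show ?thesis
          using ch[rule_format, of "2 * t - 1" x] cg[rule_format, of 1 x] t x g(3) by (simp add: k_def)
      qed
    qed
  qed
qed simp

definition reparam_class ::
    "(real^'d \<Rightarrow> real^'i \<Rightarrow> real^'o) \<Rightarrow> (real^'i) set \<Rightarrow> real^'d \<Rightarrow> (real^'d) set" where
  "reparam_class f X w = reparam_rel f X `` {w}"

definition reparam_quotient ::
    "(real^'d \<Rightarrow> real^'i \<Rightarrow> real^'o) \<Rightarrow> (real^'i) set \<Rightarrow> (real^'d) set set" where
  "reparam_quotient f X = UNIV // reparam_rel f X"

lemma reparam_class_in_quotient: "reparam_class f X w \<in> reparam_quotient f X"
  by (simp add: reparam_class_def reparam_quotient_def quotientI)

end

(* Put F w = (f w x)_x and let J be its stacked Jacobian. A path in a fibre of F need only be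
   piecewise differentiable, so it may have no length; but two nearby points a, b of one fibre
   are joined by a segment along which J (b - a) is of second order, so their pseudo-distance is
   O(|b - a|^2). Hence t |-> d(w0, gamma t) has derivative 0 off a finite set and is constant.
   Conversely, along a curve of small length F stays close to z = F w0, where the lower bound on
   the NTK yields right inverses of J of uniformly bounded norm. With J Lipschitz these give charts
   of uniform size that straighten the fibres of F. Projecting the curve to the fibre over z and
   joining nearby projections inside the charts yields a path in the fibre. *)
theory Submission
  imports Defs
begin

section \<open>Square roots of positive definite matrices\<close>

text \<open>The obstacle in the converse direction is the lack of compactness in parameter space:
  motion in the kernel of J costs no length, so a short curve may run arbitrarily far. Compactness
  is therefore taken from the outputs. The weight depends on \<open>w\<close> only through
  \<open>F w\<close>, so the closed unit ball about z bounds it above and below on the whole,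
  possibly unbounded preimage of that ball; the NTK bounds are global anyway. Hence the size of the
  charts depends on z alone, and a single short enough curve serves. Its projection to the fibre is
  chosen pointwise, with no continuity: fibre points that are close enough are linked inside one
  chart, and since being joined within the fibre is an equivalence relation, connectedness of the
  unit interval chains the links. The NTK involves a square root given by definite description, so
  roots must be shown to exist and be unique before its bounds say anything about J.\<close>

lemma inner_transpose_matrix_left:
  fixes A :: "real^'n^'m"
  shows "(transpose A *v x) \<bullet> y = x \<bullet> (A *v y)"
  by (simp add: transpose_matrix_vector dot_lmul_matrix)

lemma transpose_eq_if_self_adjoint:
  fixes A :: "real^'n^'n"
  assumes "\<And>u v. (A *v u) \<bullet> v = u \<bullet> (A *v v)"
  shows "transpose A = A"
proof -
  have "(transpose A *v u) \<bullet> v = (A *v u) \<bullet> v" for u v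
    using assms by (simp add: transpose_matrix_vector dot_lmul_matrix)
  then have "transpose A *v u = A *v u" for u
    by (meson vector_eq_rdot)
  then show ?thesis
    by (simp add: matrix_eq)
qed

lemma symmetric_matrix_inner:
  fixes A :: "real^'n^'n"
  assumes "transpose A = A"
  shows "(A *v u) \<bullet> v = u \<bullet> (A *v v)"
  by (metis assms dot_lmul_matrix transpose_matrix_vector)

lemma continuous_on_matrix_vector_mult [continuous_intros]:
  fixes A :: "'a::topological_space \<Rightarrow> real^'n^'m"
  assumes "continuous_on S A" "continuous_on S v"
  shows "continuous_on S (\<lambda>x. A x *v v x)"
  unfolding matrix_vector_mult_def
  by (intro continuous_on_vec_lambda continuous_intros continuous_on_component assms)

lemma continuous_on_matrix_matrix_mult [continuous_intros]:
  fixes A :: "'a::topological_space \<Rightarrow> real^'n^'m" and B :: "'a \<Rightarrow> real^'k^'n"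
  assumes "continuous_on S A" "continuous_on S B"
  shows "continuous_on S (\<lambda>x. A x ** B x)"
  unfolding matrix_matrix_mult_def
  by (intro continuous_on_vec_lambda continuous_intros continuous_on_component assms)

lemma continuous_on_transpose [continuous_intros]:
  fixes A :: "'a::topological_space \<Rightarrow> real^'n^'m"
  assumes "continuous_on S A"
  shows "continuous_on S (\<lambda>x. transpose (A x))"
  unfolding transpose_def
  by (intro continuous_on_vec_lambda continuous_intros continuous_on_component assms)

text \<open>By homogeneity in \<open>v\<close> only unit vectors matter, and on the compact set
  \<open>K \<times> sphere 0 1\<close> the continuous form attains its extrema, which are positive.
  \<open>K\<close> will be a ball of parameters as well as a ball of outputs.\<close>

lemma pos_def_uniform_bounds:
  fixes Q :: "'a::topological_space \<Rightarrow> real^'n^'n"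
  assumes K: "compact K" and Q: "continuous_on K Q" and pd: "\<And>z. z \<in> K \<Longrightarrow> pos_def (Q z)"
  obtains m h where "0 < m" "0 < h"
    "\<forall>z\<in>K. \<forall>v. m * (norm v)\<^sup>2 \<le> v \<bullet> (Q z *v v)"
    "\<forall>z\<in>K. \<forall>v. v \<bullet> (Q z *v v) \<le> h * (norm v)\<^sup>2"
proof (cases "K = {}")
  case True
  then show ?thesis
    using that[of 1 1] by simp
next
  case False
  define q where "q = (\<lambda>(z, v). v \<bullet> (Q z *v v))"
  have c: "continuous_on (K \<times> sphere 0 1) q"
    unfolding q_def case_prod_beta
    by (intro continuous_intros continuous_on_compose2[OF Q]) auto
  have comp: "compact (K \<times> sphere (0::real^'n) 1)"
    by (intro compact_Times K compact_sphere)
  have ne: "K \<times> sphere (0::real^'n) 1 \<noteq> {}"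
    using False by auto
  obtain a where a: "a \<in> K \<times> sphere 0 1" "\<And>b. b \<in> K \<times> sphere 0 1 \<Longrightarrow> q a \<le> q b"
    using continuous_attains_inf[OF comp ne c] by blast
  obtain b where b: "b \<in> K \<times> sphere 0 1" "\<And>a. a \<in> K \<times> sphere 0 1 \<Longrightarrow> q a \<le> q b"
    using continuous_attains_sup[OF comp ne c] by blast
  have pos: "0 < q x" if "x \<in> K \<times> sphere 0 1" for x
    using that
  proof (cases x)
    case (Pair z v)
    with that have "z \<in> K" "v \<noteq> 0"
      by auto
    then show ?thesis
      using pd[of z] by (simp add: Pair q_def pos_def_def)
  qed
  have scale: "v \<bullet> (Q z *v v) = (norm v)\<^sup>2 * q (z, v /\<^sub>R norm v)" for z v
    by (cases "v = 0") (simp_all add: q_def matrix_vector_mult_scaleR power2_eq_square field_simps)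
  have in_sphere: "(z, v /\<^sub>R norm v) \<in> K \<times> sphere 0 1" if "z \<in> K" "v \<noteq> 0" for z and v :: "real^'n"
    using that by simp
  show ?thesis
  proof (rule that[of "q a" "q b"])
    show "0 < q a" "0 < q b"
      using pos a b by auto
    have "q a * (norm v)\<^sup>2 \<le> v \<bullet> (Q z *v v)" "v \<bullet> (Q z *v v) \<le> q b * (norm v)\<^sup>2"
      if "z \<in> K" for z v
      using a(2)[OF in_sphere[OF that]] b(2)[OF in_sphere[OF that]] unfolding scale
      by (cases "v = 0"; simp add: mult.commute mult_left_mono)+
    then show "\<forall>z\<in>K. \<forall>v. q a * (norm v)\<^sup>2 \<le> v \<bullet> (Q z *v v)"
      "\<forall>z\<in>K. \<forall>v. v \<bullet> (Q z *v v) \<le> q b * (norm v)\<^sup>2"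
      by blast+
  qed
qed

lemma pos_def_bounds:
  fixes A :: "real^'n^'n"
  assumes "pos_def A"
  obtains a b where "0 < a" "0 < b" "\<And>v. a * (norm v)\<^sup>2 \<le> v \<bullet> (A *v v)" "\<And>v. norm (A *v v) \<le> b * norm v"
proof -
  \<comment> \<open>A single matrix is a family that is constant over the one-point set
    \<open>{0}\<close>.\<close>
  obtain a where "0 < a" "\<forall>x\<in>{0::real}. \<forall>v. a * (norm v)\<^sup>2 \<le> v \<bullet> (A *v v)"
    by (rule pos_def_uniform_bounds[of "{0::real}" "\<lambda>_. A"]) (auto intro: assms that)
  moreover obtain b where "0 < b" "\<And>v. norm (A *v v) \<le> b * norm v"
    using linear_bounded_pos[OF matrix_vector_mul_linear] by blast
  ultimately show ?thesis
    by (intro that[of a b]) auto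
qed

text \<open>Write \<open>A = c (I - B)\<close> with \<open>norm B < 1\<close>. If \<open>X = (B + X\<^sup>2) / 2\<close> then \<open>(I - X)\<^sup>2 = I - B\<close>, and
  such an \<open>X\<close> of norm less than 1 exists by the contraction principle.\<close>

lemma pos_def_sqrt_exists:
  fixes A :: "real^'n^'n"
  assumes "pos_def A"
  obtains S where "pos_def S" "S ** S = A"
proof -
  obtain a b where a: "0 < a" "0 < b" "\<And>v. a * (norm v)\<^sup>2 \<le> v \<bullet> (A *v v)" "\<And>v. norm (A *v v) \<le> b * norm v"
    using pos_def_bounds[OF assms] by blast
  \<comment> \<open>The squared norm of v - A v / c is at most 1 - 2 a / c + b^2 / c^2 times that of
    v; this \<open>c\<close> minimises the factor, to 1 - a^2 / b^2. The \<open>max 0\<close> in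
    \<open>q\<close> saves a proof of a \<le> b.\<close>
  define c where "c = b\<^sup>2 / a"
  have c: "c > 0"
    using a by (simp add: c_def)
  define q where "q = sqrt (max 0 (1 - a\<^sup>2 / b\<^sup>2))"
  have q: "0 \<le> q" "q < 1"
    using a by (auto simp: q_def)
  \<comment> \<open>Bounded linear maps in place of matrices, for the submultiplicative operator
    norm.\<close>
  define B where "B = Blinfun (\<lambda>v. v - (A *v v) /\<^sub>R c)"
  have B: "blinfun_apply B v = v - (A *v v) /\<^sub>R c" for v
    unfolding B_def
    by (subst bounded_linear_Blinfun_apply)
      (auto intro!: bounded_linear_intros matrix_vector_mul_bounded_linear)
  have normB: "norm B \<le> q"
  proof (rule norm_blinfun_bound)
    fix v
    have "(norm (B v))\<^sup>2 = (norm v)\<^sup>2 - 2 * (v \<bullet> (A *v v)) / c + (norm (A *v v))\<^sup>2 / c\<^sup>2"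
      unfolding power2_norm_eq_inner B
      by (simp add: inner_diff_left inner_diff_right inner_commute[of "A *v v" v] power2_eq_square
          divide_inverse algebra_simps)
    also have "\<dots> \<le> (norm v)\<^sup>2 - 2 * (a * (norm v)\<^sup>2) / c + (b * norm v)\<^sup>2 / c\<^sup>2"
      using c a by (intro add_mono diff_mono divide_right_mono mult_left_mono power_mono) auto
    also have "\<dots> = (1 - a\<^sup>2 / b\<^sup>2) * (norm v)\<^sup>2"
      using a by (simp add: c_def power2_eq_square field_simps)
    also have "\<dots> \<le> (q * norm v)\<^sup>2"
      by (simp add: q_def power_mult_distrib mult_right_mono)
    finally show "norm (B v) \<le> q * norm v"
      by (rule power2_le_imp_le) (use q in simp)
  qed (use q in auto)
  \<comment> \<open>The smaller root of r = (q + r^2) / 2, the scalar form of the fixed point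
    equation. It is both the radius of a ball preserved by \<phi> and the contraction factor
    there.\<close>
  define r where "r = 1 - sqrt (1 - q)"
  have r: "0 \<le> r" "r < 1" "(q + r * r) / 2 = r"
  proof -
    have "sqrt (1 - q) * sqrt (1 - q) = 1 - q"
      using q by simp
    then have "q + r * r = 2 * r"
      unfolding r_def by (simp add: algebra_simps del: real_sqrt_mult_self)
    then show "(q + r * r) / 2 = r"
      by simp
  qed (use q in \<open>auto simp: r_def\<close>)
  \<comment> \<open>Self-adjointness is a closed condition that \<phi> preserves; having it in the
    domain makes the root symmetric.\<close>
  define K where "K = {X :: (real^'n) \<Rightarrow>\<^sub>L (real^'n). norm X \<le> r \<and> (\<forall>u v. blinfun_apply X u \<bullet> v = u \<bullet> blinfun_apply X v)}"
  have "closed K"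
    unfolding K_def
    by (intro closed_Collect_conj closed_Collect_all closed_Collect_le closed_Collect_eq continuous_intros)
  define \<phi> where "\<phi> = (\<lambda>X. (1/2) *\<^sub>R (B + (X o\<^sub>L X)))"
  have "\<exists>!X\<in>K. \<phi> X = X"
  proof (rule Banach_fix)
    show "complete K"
      using \<open>closed K\<close> by (simp add: complete_eq_closed)
    show "K \<noteq> {}"
      using r unfolding K_def by (auto intro!: exI[of _ 0])
    show "0 \<le> r" "r < 1" by fact+
    show "\<phi> ` K \<subseteq> K"
    proof safe
      fix X :: "(real^'n) \<Rightarrow>\<^sub>L (real^'n)" assume X: "X \<in> K"
      have "norm (\<phi> X) \<le> (norm B + norm (X o\<^sub>L X)) / 2"
        unfolding \<phi>_def using norm_triangle_ineq[of B "X o\<^sub>L X"] by simp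
      also have "\<dots> \<le> (q + r * r) / 2"
        using X normB r norm_blinfun_compose[of X X] mult_mono[of "norm X" r "norm X" r]
        by (auto simp: K_def)
      finally have "norm (\<phi> X) \<le> r"
        using r by simp
      moreover have "blinfun_apply (\<phi> X) u \<bullet> v = u \<bullet> blinfun_apply (\<phi> X) v" for u v
        using X symmetric_matrix_inner[of A u v] assms
        by (simp add: \<phi>_def B K_def blinfun.bilinear_simps algebra_simps pos_def_def)
      ultimately show "\<phi> X \<in> K"
        by (simp add: K_def)
    qed
    show "dist (\<phi> X) (\<phi> Y) \<le> r * dist X Y" if "X \<in> K" "Y \<in> K" for X Y
    proof -
      \<comment> \<open>X^2 - Y^2 = X (X - Y) + (X - Y) Y, valid without commutativity.\<close>
      have e: "\<phi> X - \<phi> Y = (1/2) *\<^sub>R ((X o\<^sub>L (X - Y)) + ((X - Y) o\<^sub>L Y))"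
        by (rule blinfun_eqI) (simp add: \<phi>_def blinfun.bilinear_simps algebra_simps)
      have "norm ((X o\<^sub>L (X - Y)) + ((X - Y) o\<^sub>L Y)) \<le> norm X * norm (X - Y) + norm (X - Y) * norm Y"
        by (intro norm_triangle_mono norm_blinfun_compose)
      also have "\<dots> \<le> r * norm (X - Y) + norm (X - Y) * r"
        using that by (intro add_mono mult_mono) (auto simp: K_def r)
      finally show ?thesis
        by (simp add: dist_norm e)
    qed
  qed
  then obtain X where X: "X \<in> K" "\<phi> X = X"
    by blast
  define S where "S = matrix (\<lambda>v. sqrt c *\<^sub>R (v - X v))"
  have "linear (\<lambda>v. sqrt c *\<^sub>R (v - X v))"
    by (intro linear_compose_scale_right linear_compose_sub linear_ident bounded_linear.linear[OF blinfun.bounded_linear_right])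
  then have S: "S *v v = sqrt c *\<^sub>R (v - X v)" for v
    unfolding S_def by (simp add: matrix_works)
  have "pos_def S"
    unfolding pos_def_def
  proof (intro conjI allI impI)
    show "transpose S = S"
      using X by (intro transpose_eq_if_self_adjoint) (simp add: S K_def inner_diff_left inner_diff_right)
    fix v :: "real^'n" assume v: "v \<noteq> 0"
    have "v \<bullet> X v \<le> norm v * norm (X v)"
      by (rule norm_cauchy_schwarz)
    also have "\<dots> \<le> norm v * (r * norm v)"
      using X(1) norm_blinfun[of X v] unfolding K_def
      by (intro mult_left_mono order_trans[OF norm_blinfun] mult_right_mono) auto
    also have "\<dots> < norm v * norm v"
      using v r by simp
    also have "\<dots> = v \<bullet> v"
      by (simp add: dot_square_norm power2_eq_square)
    finally show "0 < v \<bullet> (S *v v)"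
      using c by (simp add: S inner_diff_right)
  qed
  moreover have "S ** S = A"
  proof -
    have "(S ** S) *v v = A *v v" for v
    proof -
      have "X v = (1/2) *\<^sub>R (B v + X (X v))"
        by (subst X(2)[symmetric]) (simp add: \<phi>_def blinfun.bilinear_simps)
      then have "2 *\<^sub>R X v = 2 *\<^sub>R ((1/2) *\<^sub>R (B v + X (X v)))"
        by (rule arg_cong)
      then have e: "X (X v) = 2 *\<^sub>R X v - B v"
        by simp
      have "(S ** S) *v v = (sqrt c * sqrt c) *\<^sub>R (v - X v - (X v - X (X v)))"
        unfolding matrix_vector_mul_assoc[symmetric] S
        by (simp only: blinfun.scaleR_right blinfun.diff_right scaleR_diff_right scaleR_scaleR)
      also have "\<dots> = c *\<^sub>R (v - X v - (X v - X (X v)))"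
        using c by simp
      also have "\<dots> = c *\<^sub>R (v - B v)"
        by (simp add: e scaleR_2)
      also have "\<dots> = A *v v"
        using c by (simp add: B)
      finally show ?thesis .
    qed
    then show ?thesis
      by (simp add: matrix_eq)
  qed
  ultimately show ?thesis ..
qed

text \<open>For \<open>D = S - T\<close> one has \<open>S D + D T = S\<^sup>2 - T\<^sup>2 = 0\<close>, so the traces of \<open>D S D\<close> and \<open>D T D\<close>,
  both nonnegative, add up to zero.\<close>

lemma pos_def_sqrt_unique:
  fixes S T :: "real^'n^'n"
  assumes S: "pos_def S" and T: "pos_semidef T" and eq: "T ** T = S ** S"
  shows "T = S"
proof -
  define D where "D = S - T"
  have D: "D *v v = S *v v - T *v v" for v
    by (simp add: D_def matrix_vector_mult_diff_rdistrib)
  have sym: "(S *v u) \<bullet> v = u \<bullet> (S *v v)" "(T *v u) \<bullet> v = u \<bullet> (T *v v)" for u v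
    using S T symmetric_matrix_inner unfolding pos_def_def pos_semidef_def by blast+
  have symD: "(D *v u) \<bullet> v = u \<bullet> (D *v v)" for u v
    by (simp add: D inner_diff_left inner_diff_right sym)
  have zero: "S *v (D *v v) + D *v (T *v v) = 0" for v
    using arg_cong[OF eq, of "\<lambda>M. M *v v"]
    by (simp add: D matrix_vector_mul_assoc[symmetric] matrix_vector_mult_diff_distrib)
  \<comment> \<open>Both sums are traces in the standard basis, of D (D T) and of (D T) D, and agree
    by cyclicity. This turns the mixed term of \<open>zero\<close> into the quadratic form of
    T.\<close>
  have tr: "(\<Sum>i\<in>UNIV. (D *v axis i 1) \<bullet> (D *v (T *v axis i 1)))
          = (\<Sum>i\<in>UNIV. (D *v axis i 1) \<bullet> (T *v (D *v axis i 1)))"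
  proof -
    have 1: "(D *v axis i 1) \<bullet> (D *v (T *v axis i 1)) = (D ** (D ** T)) $ i $ i" for i
      unfolding symD matrix_vector_mul_assoc
      by (simp add: inner_axis' matrix_vector_mult_basis column_def matrix_mul_assoc)
    have 2: "(D *v axis i 1) \<bullet> (T *v (D *v axis i 1)) = ((D ** T) ** D) $ i $ i" for i
      unfolding symD matrix_vector_mul_assoc
      by (simp add: inner_axis' matrix_vector_mult_basis column_def matrix_mul_assoc)
    show ?thesis
      unfolding 1 2 using trace_mul_sym[of D "D ** T"] by (simp add: trace_def)
  qed
  have "(\<Sum>i\<in>UNIV. (D *v axis i 1) \<bullet> (S *v (D *v axis i 1)) + (D *v axis i 1) \<bullet> (T *v (D *v axis i 1))) = 0"
    unfolding sum.distrib tr[symmetric] unfolding sum.distrib[symmetric] inner_add_right[symmetric] zero by simp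
  moreover have S0: "0 \<le> v \<bullet> (S *v v)" and T0: "0 \<le> v \<bullet> (T *v v)" for v
    using S T unfolding pos_def_def pos_semidef_def by (cases "v = 0"; force)+
  ultimately have "\<forall>i. (D *v axis i 1) \<bullet> (S *v (D *v axis i 1)) + (D *v axis i 1) \<bullet> (T *v (D *v axis i 1)) = 0"
    by (subst (asm) sum_nonneg_eq_0_iff) auto
  then have "(D *v axis i 1) \<bullet> (S *v (D *v axis i 1)) = 0" for i
    using S0[of "D *v axis i 1"] T0[of "D *v axis i 1"] by (metis add_nonneg_eq_0_iff)
  then have "D *v axis i 1 = 0" for i
    using S unfolding pos_def_def by force
  then have "D = 0"
    by (simp add: vec_eq_iff matrix_vector_mult_basis column_def)
  then show ?thesis
    by (simp add: D_def)
qed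

text \<open>Existence and uniqueness evaluate the definite description. Uniqueness is among positive
  semidefinite roots, as \<open>matrix_sqrt\<close> asks, yet the root comes out positive definite
  and so injective.\<close>

lemma matrix_sqrt_pos_def:
  fixes A :: "real^'n^'n"
  assumes "pos_def A"
  shows "pos_def (matrix_sqrt A)" "matrix_sqrt A ** matrix_sqrt A = A"
proof -
  obtain S where S: "pos_def S" "S ** S = A"
    using pos_def_sqrt_exists[OF assms] .
  have "pos_semidef S"
    using S(1) unfolding pos_def_def pos_semidef_def by (metis inner_zero_left less_eq_real_def)
  then have "matrix_sqrt A = S"
    unfolding matrix_sqrt_def using S pos_def_sqrt_unique by (intro the_equality) auto
  then show "pos_def (matrix_sqrt A)" "matrix_sqrt A ** matrix_sqrt A = A"
    using S by auto
qed

section \<open>Lengths of curves\<close>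

text \<open>Derivatives within a nondegenerate interval are unique, endpoints included, so any known
  derivative \<open>\<gamma>'\<close> can stand in for \<open>vector_derivative\<close>.\<close>

lemma C1_curveI:
  fixes \<gamma> :: "real \<Rightarrow> real^'d"
  assumes "\<And>t. t \<in> {0..1} \<Longrightarrow> (\<gamma> has_vector_derivative \<gamma>' t) (at t within {0..1})"
    and "continuous_on {0..1} \<gamma>'"
  shows "C1_curve \<gamma>"
    and "curve_length G \<gamma> = integral {0..1} (\<lambda>t. sqrt (\<gamma>' t \<bullet> (G (\<gamma> t) *v \<gamma>' t)))"
proof -
  have vd: "vector_derivative \<gamma> (at t within {0..1}) = \<gamma>' t" if "t \<in> {0..1}" for t
    using assms(1)[OF that] that by (intro vector_derivative_within_closed_interval) auto
  have "continuous_on {0..1} (\<lambda>t. vector_derivative \<gamma> (at t within {0..1}))"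
    using assms(2) by (subst continuous_on_cong[OF refl vd]) auto
  moreover have "\<gamma> differentiable at t within {0..1}" if "t \<in> {0..1}" for t
    using assms(1)[OF that] by (rule differentiableI_vector)
  ultimately show "C1_curve \<gamma>"
    unfolding C1_curve_def by blast
  show "curve_length G \<gamma> = integral {0..1} (\<lambda>t. sqrt (\<gamma>' t \<bullet> (G (\<gamma> t) *v \<gamma>' t)))"
    unfolding curve_length_def by (intro integral_cong) (simp add: vd)
qed

lemma C1_curveE:
  fixes \<gamma> :: "real \<Rightarrow> real^'d"
  assumes "C1_curve \<gamma>"
  obtains \<gamma>' where "\<And>t. t \<in> {0..1} \<Longrightarrow> (\<gamma> has_vector_derivative \<gamma>' t) (at t within {0..1})"
    and "continuous_on {0..1} \<gamma>'" and "continuous_on {0..1} \<gamma>"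
proof -
  have "(\<gamma> has_vector_derivative vector_derivative \<gamma> (at t within {0..1})) (at t within {0..1})"
    if "t \<in> {0..1}" for t
    using assms that unfolding C1_curve_def by (simp add: vector_derivative_works)
  moreover from this have "continuous_on {0..1} \<gamma>"
    unfolding continuous_on_eq_continuous_within
    by (blast intro: has_vector_derivative_continuous)
  moreover have "continuous_on {0..1} (\<lambda>t. vector_derivative \<gamma> (at t within {0..1}))"
    using assms unfolding C1_curve_def by blast
  ultimately show ?thesis
    by (intro that)
qed

text \<open>Admissible curves have no corners, so the triangle inequality needs a concatenation that
  is C1 at the joint too. Slowing down there costs nothing: the length integrand is positively
  homogeneous in the velocity, which makes length invariant under monotone
  reparametrisation.\<close>

lemma C1_curve_join:
  fixes \<gamma> \<eta> :: "real \<Rightarrow> real^'d"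
  assumes G: "continuous_on UNIV G"
    and \<gamma>: "C1_curve \<gamma>" and \<eta>: "C1_curve \<eta>" and eq: "\<gamma> 1 = \<eta> 0"
  obtains \<kappa> where "C1_curve \<kappa>" "\<kappa> 0 = \<gamma> 0" "\<kappa> 1 = \<eta> 1"
    "curve_length G \<kappa> = curve_length G \<gamma> + curve_length G \<eta>"
proof -
  obtain \<gamma>' where \<gamma>': "\<And>t. t \<in> {0..1} \<Longrightarrow> (\<gamma> has_vector_derivative \<gamma>' t) (at t within {0..1})"
    "continuous_on {0..1} \<gamma>'" "continuous_on {0..1} \<gamma>"
    using C1_curveE[OF \<gamma>] by metis
  obtain \<eta>' where \<eta>': "\<And>t. t \<in> {0..1} \<Longrightarrow> (\<eta> has_vector_derivative \<eta>' t) (at t within {0..1})"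
    "continuous_on {0..1} \<eta>'" "continuous_on {0..1} \<eta>"
    using C1_curveE[OF \<eta>] by metis
  define s :: "real \<Rightarrow> real" where "s = (\<lambda>t. t\<^sup>2 * (3 - 2 * t))"
  define s' :: "real \<Rightarrow> real" where "s' = (\<lambda>t. 6 * t * (1 - t))"
  have s: "s t \<in> {0..1}" if "t \<in> {0..1}" for t
  proof -
    have "1 - s t = (1 - t)\<^sup>2 * (1 + 2 * t)"
      by (simp add: s_def power2_eq_square algebra_simps)
    moreover have "0 \<le> (1 - t)\<^sup>2 * (1 + 2 * t)" "0 \<le> s t"
      using that by (auto simp: s_def)
    ultimately show ?thesis
      by simp
  qed
  have sd: "(s has_real_derivative s' t) (at t within A)" for t A
    unfolding s_def s'_def
    by (auto intro!: derivative_eq_intros simp: power2_eq_square algebra_simps)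
  have s'0: "0 \<le> s' t" if "t \<in> {0..1}" for t
    using that by (auto simp: s'_def)
  have cs: "continuous_on A s" "continuous_on A s'" for A
    unfolding s_def s'_def by (intro continuous_intros)+
  text \<open>The speed of the smoothstep \<open>s\<close> vanishes at both ends, so the pieces match up to
    first order.\<close>
  define \<kappa> where "\<kappa> = (\<lambda>t. if t \<in> {0..1/2} then \<gamma> (s (2 * t)) else \<eta> (s (2 * t - 1)))"
  define \<kappa>' where "\<kappa>' = (\<lambda>t. if t \<in> {0..1/2} then (2 * s' (2 * t)) *\<^sub>R \<gamma>' (s (2 * t))
                                 else (2 * s' (2 * t - 1)) *\<^sub>R \<eta>' (s (2 * t - 1)))"
  have d1: "((\<lambda>t. \<gamma> (s (2 * t))) has_vector_derivative (2 * s' (2 * t)) *\<^sub>R \<gamma>' (s (2 * t)))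
      (at t within {0..1/2})" if "t \<in> {0..1/2}" for t
  proof -
    have "((\<lambda>t. s (2 * t)) has_vector_derivative (2 * s' (2 * t))) (at t within {0..1/2})"
      unfolding has_real_derivative_iff_has_vector_derivative[symmetric]
      by (rule DERIV_chain'[where g = s, OF _ sd, THEN DERIV_cong]) (auto intro!: derivative_eq_intros)
    moreover have "(\<gamma> has_vector_derivative \<gamma>' (s (2 * t))) (at (s (2 * t)) within (\<lambda>t. s (2 * t)) ` {0..1/2})"
      using that s by (intro has_vector_derivative_within_subset[OF \<gamma>'(1)] image_subsetI) simp_all
    ultimately show ?thesis
      by (rule vector_diff_chain_within[unfolded o_def])
  qed
  have d2: "((\<lambda>t. \<eta> (s (2 * t - 1))) has_vector_derivative (2 * s' (2 * t - 1)) *\<^sub>R \<eta>' (s (2 * t - 1)))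
      (at t within {1/2..1})" if "t \<in> {1/2..1}" for t
  proof -
    have "((\<lambda>t. s (2 * t - 1)) has_vector_derivative (2 * s' (2 * t - 1))) (at t within {1/2..1})"
      unfolding has_real_derivative_iff_has_vector_derivative[symmetric]
      by (rule DERIV_chain'[where g = s, OF _ sd, THEN DERIV_cong]) (auto intro!: derivative_eq_intros)
    moreover have "(\<eta> has_vector_derivative \<eta>' (s (2 * t - 1))) (at (s (2 * t - 1)) within (\<lambda>t. s (2 * t - 1)) ` {1/2..1})"
      using that s by (intro has_vector_derivative_within_subset[OF \<eta>'(1)] image_subsetI) simp_all
    ultimately show ?thesis
      by (rule vector_diff_chain_within[unfolded o_def])
  qed
  have mid: "t = 1/2" if "t \<le> 1/2" "1/2 \<le> t" for t :: real
    using that by simp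
  have un: "{0..1/2} \<union> closure {0..1/2} \<inter> closure {1/2..1} = {0..1/2::real}"
    "{1/2..1} \<union> closure {0..1/2} \<inter> closure {1/2..1} = {1/2..1::real}"
    by auto
  have \<kappa>d: "(\<kappa> has_vector_derivative \<kappa>' t) (at t within {0..1})" if "t \<in> {0..1}" for t
    unfolding \<kappa>_def \<kappa>'_def
  proof (rule has_vector_derivative_If_within_closures[where T = "{1/2..1}"], goal_cases)
    case 3
    then show ?case using d1 by (simp only: un)
  next
    case 4
    then show ?case using d2 by (simp only: un)
  next
    case 5
    then have t: "t = 1/2" using mid by simp
    show ?case unfolding t by (simp add: s_def eq)
  next
    case 6
    then have t: "t = 1/2" using mid by simp
    show ?case unfolding t by (simp add: s'_def)
  qed (use that in auto)
  have c1: "continuous_on {0..1/2} (\<lambda>t. (2 * s' (2 * t)) *\<^sub>R \<gamma>' (s (2 * t)))"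
    using s by (intro continuous_intros continuous_on_compose2[OF \<gamma>'(2)]
        continuous_on_compose2[OF cs(1)] continuous_on_compose2[OF cs(2)]) auto
  have c2: "continuous_on {1/2..1} (\<lambda>t. (2 * s' (2 * t - 1)) *\<^sub>R \<eta>' (s (2 * t - 1)))"
    using s by (intro continuous_intros continuous_on_compose2[OF \<eta>'(2)]
        continuous_on_compose2[OF cs(1)] continuous_on_compose2[OF cs(2)]) auto
  have "continuous_on ({0..1/2} \<union> {1/2..1}) \<kappa>'"
    unfolding \<kappa>'_def
  proof (rule continuous_on_cases[OF _ _ c1 c2], goal_cases)
    case 3
    have "(2 * s' (2 * t)) *\<^sub>R \<gamma>' (s (2 * t)) = (2 * s' (2 * t - 1)) *\<^sub>R \<eta>' (s (2 * t - 1))"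
      if "t = 1/2" for t
      unfolding that by (simp add: s'_def)
    then show ?case
      using mid by auto
  qed auto
  then have \<kappa>'c: "continuous_on {0..1} \<kappa>'"
    by (simp add: ivl_disj_un)
  note \<kappa> = C1_curveI[OF \<kappa>d \<kappa>'c]
  define u where "u = (\<lambda>t. sqrt (\<gamma>' t \<bullet> (G (\<gamma> t) *v \<gamma>' t)))"
  define v where "v = (\<lambda>t. sqrt (\<eta>' t \<bullet> (G (\<eta> t) *v \<eta>' t)))"
  define k where "k = (\<lambda>t. sqrt (\<kappa>' t \<bullet> (G (\<kappa> t) *v \<kappa>' t)))"
  have cu: "continuous_on {0..1} u" and cv: "continuous_on {0..1} v"
    unfolding u_def v_def
    by (intro continuous_intros \<gamma>' \<eta>' continuous_on_compose2[OF G] subset_UNIV)+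
  have "((\<lambda>t. (2 * s' (2 * t)) *\<^sub>R u (s (2 * t))) has_integral integral {s (2 * 0)..s (2 * (1/2))} u) {0..1/2}"
  proof (rule has_integral_substitution[OF _ _ _ cu])
    show "(\<lambda>t. s (2 * t)) ` {0..1/2} \<subseteq> {0..1}"
      using s by (intro image_subsetI) simp
    show "((\<lambda>t. s (2 * t)) has_real_derivative 2 * s' (2 * t)) (at t within {0..1/2})" for t
      by (rule DERIV_chain'[where g = s, OF _ sd, THEN DERIV_cong]) (auto intro!: derivative_eq_intros)
  qed (simp_all add: s_def)
  moreover have "k t = (2 * s' (2 * t)) *\<^sub>R u (s (2 * t))" if "t \<in> {0..1/2}" for t
    using that s'0[of "2 * t"]
    by (simp add: k_def u_def \<kappa>_def \<kappa>'_def matrix_vector_mult_scaleR real_sqrt_mult flip: mult.assoc)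
  ultimately have k1: "(k has_integral integral {0..1} u) {0..1/2}"
    by (subst has_integral_cong) (auto simp: s_def)
  have "((\<lambda>t. (2 * s' (2 * t - 1)) *\<^sub>R v (s (2 * t - 1))) has_integral integral {s (2 * (1/2) - 1)..s (2 * 1 - 1)} v) {1/2..1}"
  proof (rule has_integral_substitution[OF _ _ _ cv])
    show "(\<lambda>t. s (2 * t - 1)) ` {1/2..1} \<subseteq> {0..1}"
      using s by (intro image_subsetI) simp
    show "((\<lambda>t. s (2 * t - 1)) has_real_derivative 2 * s' (2 * t - 1)) (at t within {1/2..1})" for t
      by (rule DERIV_chain'[where g = s, OF _ sd, THEN DERIV_cong]) (auto intro!: derivative_eq_intros)
  qed (simp_all add: s_def)
  moreover have "k t = (2 * s' (2 * t - 1)) *\<^sub>R v (s (2 * t - 1))" if "t \<in> {1/2..1}" for t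
  \<comment> \<open>At the joint \<open>\<kappa>'\<close> takes its value from the first branch;
    both sides are 0 because \<open>s'\<close> vanishes at 0 and 1.\<close>
  proof (cases "t = 1/2")
    case True
    show ?thesis
      unfolding True by (simp add: k_def \<kappa>'_def s'_def)
  next
    case False
    then show ?thesis
      using that s'0[of "2 * t - 1"]
      by (simp add: k_def v_def \<kappa>_def \<kappa>'_def matrix_vector_mult_scaleR real_sqrt_mult flip: mult.assoc)
  qed
  ultimately have k2: "(k has_integral integral {0..1} v) {1/2..1}"
    by (subst has_integral_cong) (auto simp: s_def)
  have "(k has_integral integral {0..1} u + integral {0..1} v) {0..1}"
    using has_integral_combine[OF _ _ k1 k2] by simp
  then have "curve_length G \<kappa> = curve_length G \<gamma> + curve_length G \<eta>"
    using \<kappa>(2)[of G] C1_curveI(2)[OF \<gamma>'(1,2), of G] C1_curveI(2)[OF \<eta>'(1,2), of G]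
    by (simp add: k_def u_def v_def integral_unique)
  then show ?thesis
    using \<kappa>(1) by (intro that[of \<kappa>]) (auto simp: \<kappa>_def s_def)
qed

lemma C1_curve_linepath:
  fixes a b :: "real^'d"
  shows "C1_curve (\<lambda>t. a + t *\<^sub>R (b - a))"
    and "curve_length G (\<lambda>t. a + t *\<^sub>R (b - a)) =
      integral {0..1} (\<lambda>t. sqrt ((b - a) \<bullet> (G (a + t *\<^sub>R (b - a)) *v (b - a))))"
proof -
  have "((\<lambda>t. a + t *\<^sub>R (b - a)) has_vector_derivative (b - a)) (at t within {0..1})" for t
    by (auto intro!: derivative_eq_intros)
  then show "C1_curve (\<lambda>t. a + t *\<^sub>R (b - a))"
    "curve_length G (\<lambda>t. a + t *\<^sub>R (b - a)) =
      integral {0..1} (\<lambda>t. sqrt ((b - a) \<bullet> (G (a + t *\<^sub>R (b - a)) *v (b - a))))"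
    using C1_curveI[where \<gamma> = "\<lambda>t. a + t *\<^sub>R (b - a)" and \<gamma>' = "\<lambda>_. b - a"] by auto
qed

locale continuous_pseudo_metric =
  fixes G :: "real^'d \<Rightarrow> real^'d^'d"
  assumes continuous: "continuous_on UNIV G"
    and nonneg: "0 \<le> v \<bullet> (G w *v v)"
begin

text \<open>True of every \<open>\<gamma>\<close>, however irregular: an integrand that is not
  integrable has integral 0 by default.\<close>

lemma curve_length_nonneg: "0 \<le> curve_length G \<gamma>"
  unfolding curve_length_def
  by (cases "(\<lambda>t. sqrt (vector_derivative \<gamma> (at t within {0..1}) \<bullet>
        (G (\<gamma> t) *v vector_derivative \<gamma> (at t within {0..1})))) integrable_on {0..1}")
    (auto intro!: integral_nonneg simp: nonneg not_integrable_integral)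

lemma geodesic_dist_le:
  assumes "C1_curve \<gamma>" "\<gamma> 0 = a" "\<gamma> 1 = b"
  shows "geodesic_dist G a b \<le> curve_length G \<gamma>"
  unfolding geodesic_dist_def using assms curve_length_nonneg
  by (intro cInf_lower bdd_belowI[of _ 0]) auto

lemma geodesic_dist_lessE:
  assumes "geodesic_dist G a b < e"
  obtains \<gamma> where "C1_curve \<gamma>" "\<gamma> 0 = a" "\<gamma> 1 = b" "curve_length G \<gamma> < e"
proof -
  \<comment> \<open>The straight segment shows that the set is nonempty, so that its
    \<open>Inf\<close> is approached by lengths of curves.\<close>
  have "{curve_length G \<gamma> | \<gamma>. C1_curve \<gamma> \<and> \<gamma> 0 = a \<and> \<gamma> 1 = b} \<noteq> {}"
    using C1_curve_linepath(1)[of a b] by fastforce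
  from cInf_lessD[OF this assms[unfolded geodesic_dist_def]] that show ?thesis
    by blast
qed

lemma geodesic_dist_nonneg: "0 \<le> geodesic_dist G a b"
  by (meson curve_length_nonneg geodesic_dist_lessE not_le order_less_le_trans)

lemma geodesic_dist_refl: "geodesic_dist G a a = 0"
proof -
  have "geodesic_dist G a a \<le> curve_length G (\<lambda>t. a + t *\<^sub>R (a - a))"
    by (intro geodesic_dist_le C1_curve_linepath) auto
  also have "\<dots> = 0"
    unfolding C1_curve_linepath(2) by simp
  finally show ?thesis
    using geodesic_dist_nonneg[of a a] by simp
qed

lemma geodesic_dist_triangle: "geodesic_dist G a c \<le> geodesic_dist G a b + geodesic_dist G b c"
proof (rule field_le_epsilon)
  fix e :: real assume e: "e > 0"
  obtain \<gamma> where \<gamma>: "C1_curve \<gamma>" "\<gamma> 0 = a" "\<gamma> 1 = b" "curve_length G \<gamma> < geodesic_dist G a b + e / 2"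
    using geodesic_dist_lessE[of a b "geodesic_dist G a b + e / 2"] e by auto
  obtain \<eta> where \<eta>: "C1_curve \<eta>" "\<eta> 0 = b" "\<eta> 1 = c" "curve_length G \<eta> < geodesic_dist G b c + e / 2"
    using geodesic_dist_lessE[of b c "geodesic_dist G b c + e / 2"] e by auto
  obtain \<kappa> where "C1_curve \<kappa>" "\<kappa> 0 = a" "\<kappa> 1 = c"
    "curve_length G \<kappa> = curve_length G \<gamma> + curve_length G \<eta>"
    using C1_curve_join[OF continuous \<gamma>(1) \<eta>(1)] \<gamma> \<eta> by metis
  then show "geodesic_dist G a c \<le> geodesic_dist G a b + geodesic_dist G b c + e"
    using geodesic_dist_le[of \<kappa> a c] \<gamma>(4) \<eta>(4) by simp
qed

end

section \<open>A quantitative inverse function theorem\<close>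

text \<open>\<Psi> minus the identity is 1/2-Lipschitz on the ball, so each \<open>y\<close> in the
  smaller ball is reached by a contraction. The point, compared with the usual inverse function
  theorem, is the explicit radius \<rho> / 2 and the constants 2 and 3/2: they make charts at
  different points uniform.\<close>

lemma local_inverse_near_identity:
  fixes \<Psi> :: "'a::euclidean_space \<Rightarrow> 'a"
  assumes deriv: "\<And>u. u \<in> cball w \<rho> \<Longrightarrow> (\<Psi> has_derivative \<Psi>' u) (at u)"
    and near: "\<And>u h. u \<in> cball w \<rho> \<Longrightarrow> norm (\<Psi>' u h - h) \<le> norm h / 2"
    and "0 \<le> \<rho>"
  obtains g where
    "\<And>y. y \<in> cball (\<Psi> w) (\<rho> / 2) \<Longrightarrow> \<Psi> (g y) = y"
    "\<And>u. u \<in> cball w \<rho> \<Longrightarrow> \<Psi> u \<in> cball (\<Psi> w) (\<rho> / 2) \<Longrightarrow> g (\<Psi> u) = u"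
    "\<And>y. y \<in> cball (\<Psi> w) (\<rho> / 2) \<Longrightarrow> norm (g y - w) \<le> 2 * norm (y - \<Psi> w)"
    "\<And>y. y \<in> ball (\<Psi> w) (\<rho> / 2) \<Longrightarrow> g differentiable (at y)"
    "\<And>u. u \<in> cball w \<rho> \<Longrightarrow> norm (\<Psi> u - \<Psi> w) \<le> 3 / 2 * norm (u - w)"
proof -
  have close: "norm ((\<Psi> u - u) - (\<Psi> v - v)) \<le> 1 / 2 * norm (u - v)"
    if "u \<in> cball w \<rho>" "v \<in> cball w \<rho>" for u v
  proof (rule differentiable_bound[where S = "cball w \<rho>" and f = "\<lambda>u. \<Psi> u - u"])
    show "((\<lambda>u. \<Psi> u - u) has_derivative (\<lambda>h. \<Psi>' u h - h)) (at u within cball w \<rho>)"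
      if "u \<in> cball w \<rho>" for u
      using deriv[OF that] by (auto intro!: derivative_eq_intros intro: has_derivative_at_withinI)
    show "onorm (\<lambda>h. \<Psi>' u h - h) \<le> 1 / 2" if "u \<in> cball w \<rho>" for u
      using near[OF that] by (intro onorm_le) simp
  qed (use that in auto)
  have expand: "norm (u - v) \<le> 2 * norm (\<Psi> u - \<Psi> v)"
    and lip: "norm (\<Psi> u - \<Psi> v) \<le> 3 / 2 * norm (u - v)"
    if "u \<in> cball w \<rho>" "v \<in> cball w \<rho>" for u v
  proof -
    have e: "(\<Psi> u - u) - (\<Psi> v - v) = (\<Psi> u - \<Psi> v) - (u - v)"
      by simp
    show "norm (u - v) \<le> 2 * norm (\<Psi> u - \<Psi> v)" "norm (\<Psi> u - \<Psi> v) \<le> 3 / 2 * norm (u - v)"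
      using close[OF that] norm_triangle_ineq2[of "u - v" "\<Psi> u - \<Psi> v"]
        norm_triangle_ineq2[of "\<Psi> u - \<Psi> v" "u - v"]
      unfolding e by (simp_all add: norm_minus_commute[of "u - v"])
  qed
  have ex: "\<exists>u\<in>cball w \<rho>. \<Psi> u = y" if y: "y \<in> cball (\<Psi> w) (\<rho> / 2)" for y
  proof -
    \<comment> \<open>Fixed points of this map are the solutions of \<Psi> u = y. It preserves the
      ball because \<open>y\<close> and the contracted part displace the centre by at most \<rho> /
      2 each.\<close>
    have "\<exists>!u\<in>cball w \<rho>. u - \<Psi> u + y = u"
    proof (rule Banach_fix[where c = "1/2"])
      show "dist (u - \<Psi> u + y) (v - \<Psi> v + y) \<le> 1 / 2 * dist u v"
        if "u \<in> cball w \<rho>" "v \<in> cball w \<rho>" for u v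
      proof -
        have "norm (u - \<Psi> u + y - (v - \<Psi> v + y)) = norm ((\<Psi> u - u) - (\<Psi> v - v))"
          by (subst norm_minus_commute) (simp add: algebra_simps)
        then show ?thesis
          using close[OF that] by (simp add: dist_norm)
      qed
      show "(\<lambda>u. u - \<Psi> u + y) ` cball w \<rho> \<subseteq> cball w \<rho>"
      proof (rule image_subsetI)
        fix u assume u: "u \<in> cball w \<rho>"
        have "norm (u - \<Psi> u + y - w) = norm ((y - \<Psi> w) - ((\<Psi> u - u) - (\<Psi> w - w)))"
          by (simp add: algebra_simps)
        also have "\<dots> \<le> norm (y - \<Psi> w) + norm ((\<Psi> u - u) - (\<Psi> w - w))"
          by (rule norm_triangle_ineq4)
        also have "\<dots> \<le> \<rho> / 2 + 1 / 2 * norm (u - w)"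
          using y u close[OF u, of w] \<open>0 \<le> \<rho>\<close>
          by (intro add_mono) (auto simp: dist_norm norm_minus_commute)
        also have "\<dots> \<le> \<rho>"
          using u by (simp add: dist_norm norm_minus_commute)
        finally show "u - \<Psi> u + y \<in> cball w \<rho>"
          by (simp add: dist_norm norm_minus_commute)
      qed
    qed (use \<open>0 \<le> \<rho>\<close> in \<open>auto simp: complete_eq_closed\<close>)
    then obtain u where "u \<in> cball w \<rho>" "u - \<Psi> u + y = u"
      by blast
    moreover from this(2) have "\<Psi> u = y"
      by (metis add.commute add_diff_eq add_left_cancel diff_add_cancel)
    ultimately show ?thesis
      by blast
  qed
  have "\<forall>y\<in>cball (\<Psi> w) (\<rho> / 2). \<exists>u. u \<in> cball w \<rho> \<and> \<Psi> u = y"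
    using ex by blast
  from bchoice[OF this] obtain g
    where g: "\<And>y. y \<in> cball (\<Psi> w) (\<rho> / 2) \<Longrightarrow> g y \<in> cball w \<rho>"
      "\<And>y. y \<in> cball (\<Psi> w) (\<rho> / 2) \<Longrightarrow> \<Psi> (g y) = y"
    by blast
  have w: "w \<in> cball w \<rho>"
    using \<open>0 \<le> \<rho>\<close> by simp
  show ?thesis
  proof
    show "\<Psi> (g y) = y" if "y \<in> cball (\<Psi> w) (\<rho> / 2)" for y
      using g that by blast
    show "g (\<Psi> u) = u" if "u \<in> cball w \<rho>" "\<Psi> u \<in> cball (\<Psi> w) (\<rho> / 2)" for u
      using expand[OF g(1) that(1), OF that(2)] g(2)[OF that(2)] by simp
    show "norm (g y - w) \<le> 2 * norm (y - \<Psi> w)" if "y \<in> cball (\<Psi> w) (\<rho> / 2)" for y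
      using expand[OF g(1)[OF that] w] g(2)[OF that] by simp
    show "norm (\<Psi> u - \<Psi> w) \<le> 3 / 2 * norm (u - w)" if "u \<in> cball w \<rho>" for u
      by (rule lip[OF that w])
    show "g differentiable (at y)" if y: "y \<in> ball (\<Psi> w) (\<rho> / 2)" for y
    proof -
      have y': "y \<in> cball (\<Psi> w) (\<rho> / 2)"
        using y by simp
      note gy = g[OF y']
      have lin: "linear (\<Psi>' (g y))"
        using deriv[OF gy(1)] by (rule has_derivative_linear)
      \<comment> \<open>By \<open>near\<close>, such an \<open>h\<close> has norm h \<le> norm h /
        2. The left inverse that injectivity provides is the derivative of \<open>g\<close>.\<close>
      have "h = 0" if "\<Psi>' (g y) h = 0" for h
        using near[OF gy(1), of h] that by simp
      then have "inj (\<Psi>' (g y))"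
        using lin by (simp add: linear_injective_0)
      then obtain k where k: "linear k" "k \<circ> \<Psi>' (g y) = id"
        using linear_injective_left_inverse[OF lin] by blast
      have "2-lipschitz_on (ball (\<Psi> w) (\<rho> / 2)) g"
      proof (rule lipschitz_onI)
        fix a b assume "a \<in> ball (\<Psi> w) (\<rho> / 2)" "b \<in> ball (\<Psi> w) (\<rho> / 2)"
        then have "a \<in> cball (\<Psi> w) (\<rho> / 2)" "b \<in> cball (\<Psi> w) (\<rho> / 2)"
          by simp_all
        then show "dist (g a) (g b) \<le> 2 * dist a b"
          using expand[OF g(1) g(1)] g(2) by (metis dist_norm)
      qed simp
      then have "continuous (at y) g"
        using lipschitz_on_continuous_on continuous_on_eq_continuous_at y by blast
      then have "(g has_derivative k) (at y)"
        using g(2) k(1)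
        by (intro has_derivative_inverse_basic[where f = \<Psi> and g = g and y = y, OF deriv[OF gy(1)] _ k(2) _ open_ball y])
          (simp_all add: linear_conv_bounded_linear)
      then show ?thesis
        by (rule differentiableI)
    qed
  qed
qed

text \<open>Where \<gamma> has derivative v, the difference quotient of D is at most |M| norm
  (\<gamma> s - \<gamma> t) times a quantity tending to norm v, so it tends to 0. At the finitely
  many exceptional times the same bound and the continuity of \<gamma> still make D continuous,
  which is enough for constancy.\<close>

lemma constant_along_piecewise_differentiable:
  fixes \<gamma> :: "real \<Rightarrow> 'a::real_normed_vector" and D :: "real \<Rightarrow> real"
  assumes \<gamma>: "\<gamma> piecewise_differentiable_on {a..b}"
    and D: "\<And>t. t \<in> {a..b} \<Longrightarrow>
      \<exists>M. \<forall>\<^sub>F s in at t within {a..b}. \<bar>D s - D t\<bar> \<le> M * (norm (\<gamma> s - \<gamma> t))\<^sup>2"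
    and t: "t \<in> {a..b}"
  shows "D t = D a"
proof -
  obtain S where S: "finite S" "\<And>t. t \<in> {a..b} - S \<Longrightarrow> \<gamma> differentiable (at t within {a..b})"
    and c: "continuous_on {a..b} \<gamma>"
    using \<gamma> unfolding piecewise_differentiable_on_def by blast
  have lim: "((\<lambda>s. norm (\<gamma> s - \<gamma> t)) \<longlongrightarrow> 0) (at t within {a..b})" if "t \<in> {a..b}" for t
    using c that by (simp add: continuous_on_def tendsto_norm_zero LIM_zero)
  show ?thesis
  proof (rule has_derivative_zero_unique_strong_interval[OF S(1) _ refl _ t])
    show "continuous_on {a..b} D"
      unfolding continuous_on_def
    proof
      fix t assume t: "t \<in> {a..b}"
      obtain M where M: "\<forall>\<^sub>F s in at t within {a..b}. \<bar>D s - D t\<bar> \<le> M * (norm (\<gamma> s - \<gamma> t))\<^sup>2"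
        using D[OF t] by blast
      have "((\<lambda>s. M * (norm (\<gamma> s - \<gamma> t))\<^sup>2) \<longlongrightarrow> M * 0\<^sup>2) (at t within {a..b})"
        by (intro tendsto_intros lim[OF t])
      then have "((\<lambda>s. M * (norm (\<gamma> s - \<gamma> t))\<^sup>2) \<longlongrightarrow> 0) (at t within {a..b})"
        by (simp only: power_zero_numeral mult_zero_right)
      then have "((\<lambda>s. D s - D t) \<longlongrightarrow> 0) (at t within {a..b})"
        by (rule Lim_null_comparison[rotated]) (simp only: real_norm_def M)
      then show "(D \<longlongrightarrow> D t) (at t within {a..b})"
        by (rule LIM_zero_cancel)
    qed
    fix t assume tS: "t \<in> {a..b} - S"
    then have t: "t \<in> {a..b}"
      by blast
    obtain M where M: "\<forall>\<^sub>F s in at t within {a..b}. \<bar>D s - D t\<bar> \<le> M * (norm (\<gamma> s - \<gamma> t))\<^sup>2"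
      using D[OF t] by blast
    obtain v where "(\<gamma> has_vector_derivative v) (at t within {a..b})"
      using S(2)[OF tS] by (auto simp: vector_derivative_works)
    then have v: "((\<lambda>s. norm (\<gamma> s - \<gamma> t - (s - t) *\<^sub>R v) / norm (s - t)) \<longlongrightarrow> 0) (at t within {a..b})"
      unfolding has_vector_derivative_def has_derivative_iff_norm by blast
    \<comment> \<open>A bound for the difference quotient up to sign; \<open>M\<close> may be
      negative, hence the absolute value of \<open>\<beta>\<close> below.\<close>
    define \<beta> where "\<beta> s = M * norm (\<gamma> s - \<gamma> t) *
        (norm (\<gamma> s - \<gamma> t - (s - t) *\<^sub>R v) / norm (s - t) + norm v)" for s
    have "(\<beta> \<longlongrightarrow> M * 0 * (0 + norm v)) (at t within {a..b})"
      unfolding \<beta>_def by (intro tendsto_intros lim[OF t] v)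
    then have "((\<lambda>s. \<bar>\<beta> s\<bar>) \<longlongrightarrow> 0) (at t within {a..b})"
      by (intro tendsto_rabs_zero) (simp only: mult_zero_right mult_zero_left)
    moreover have "\<forall>\<^sub>F s in at t within {a..b}. norm (norm (D s - D t) / norm (s - t)) \<le> \<bar>\<beta> s\<bar>"
      using M
    proof eventually_elim
      case (elim s)
      have "norm (\<gamma> s - \<gamma> t) / norm (s - t)
          \<le> norm (\<gamma> s - \<gamma> t - (s - t) *\<^sub>R v) / norm (s - t) + norm v"
      proof (cases "s = t")
        case False
        have "norm (\<gamma> s - \<gamma> t) \<le> norm (\<gamma> s - \<gamma> t - (s - t) *\<^sub>R v) + norm ((s - t) *\<^sub>R v)"
          by (metis diff_add_cancel norm_triangle_ineq)
        then have "norm (\<gamma> s - \<gamma> t) / norm (s - t)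
            \<le> (norm (\<gamma> s - \<gamma> t - (s - t) *\<^sub>R v) + norm ((s - t) *\<^sub>R v)) / norm (s - t)"
          by (rule divide_right_mono) simp
        then show ?thesis
          using False by (simp add: add_divide_distrib)
      qed simp
      then have "\<bar>M\<bar> * norm (\<gamma> s - \<gamma> t) * (norm (\<gamma> s - \<gamma> t) / norm (s - t)) \<le> \<bar>\<beta> s\<bar>"
        unfolding \<beta>_def abs_mult by (intro mult_mono) auto
      moreover have "\<bar>D s - D t\<bar> / norm (s - t) \<le> \<bar>M\<bar> * (norm (\<gamma> s - \<gamma> t))\<^sup>2 / norm (s - t)"
        by (intro divide_right_mono order_trans[OF elim] mult_right_mono) auto
      ultimately show ?case
        by (simp add: power2_eq_square mult.assoc)
    qed
    ultimately have "((\<lambda>s. norm (D s - D t) / norm (s - t)) \<longlongrightarrow> 0) (at t within {a..b})"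
      by (rule Lim_null_comparison[rotated])
    then show "(D has_derivative (\<lambda>h. 0)) (at t within {a..b})"
      by (simp only: has_derivative_iff_norm diff_zero bounded_linear_zero simp_thms)
  qed
qed

section \<open>Pullback of a metric along a submersion\<close>

text \<open>The network with its inputs stripped away: \<open>F\<close> will be the stacked outputs
  on the training set. The weight \<open>Q\<close> is a function of the output, not of
  \<open>w\<close>. The lower NTK bound makes every \<open>J w\<close> surjective, so that
  \<open>F\<close> is a submersion.\<close>

locale pullback_geometry =
  fixes F :: "real^'d \<Rightarrow> real^'m" and J :: "real^'d \<Rightarrow> real^'d^'m"
    and Q :: "real^'m \<Rightarrow> real^'m^'m" and C l L :: real
  assumes F_deriv: "(F has_derivative (\<lambda>h. J w *v h)) (at w)"
    and J_continuous: "continuous_on UNIV J"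
    and J_lipschitz: "norm (J u *v h - J w *v h) \<le> C * norm (u - w) * norm h"
    and C_pos: "0 < C"
    and Q_continuous: "continuous_on UNIV Q"
    and Q_pos_def: "pos_def (Q z)"
    and l_pos: "0 < l" and L_nonneg: "0 \<le> L"
    and NTK_lower: "l * norm v \<le> norm ((matrix_sqrt (Q (F w)) ** J w ** transpose (J w) ** matrix_sqrt (Q (F w))) *v v)"
    and NTK_upper: "norm ((matrix_sqrt (Q (F w)) ** J w ** transpose (J w) ** matrix_sqrt (Q (F w))) *v v) \<le> L * norm v"
begin

definition G :: "real^'d \<Rightarrow> real^'d^'d" where
  "G w = transpose (J w) ** Q (F w) ** J w"

lemma inner_G: "v \<bullet> (G w *v v) = (J w *v v) \<bullet> (Q (F w) *v (J w *v v))"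
  unfolding G_def matrix_vector_mul_assoc[symmetric]
  by (metis inner_commute inner_transpose_matrix_left)

lemma F_continuous: "continuous_on A F"
  using F_deriv has_derivative_continuous continuous_at_imp_continuous_on by blast

sublocale continuous_pseudo_metric G
proof
  show "continuous_on UNIV G"
    unfolding G_def
    by (intro continuous_intros J_continuous continuous_on_compose2[OF Q_continuous] F_continuous) auto
  show "0 \<le> v \<bullet> (G w *v v)" for v w
    using Q_pos_def[of "F w"] unfolding inner_G pos_def_def
    by (cases "J w *v v = 0") (auto simp: less_imp_le)
qed

section \<open>Piecewise differentiable paths inside a fibre\<close>

text \<open>The remainder has derivative J u - J a, of norm at most C norm (b - a) on the ball about
  \<open>a\<close> through \<open>b\<close>. Integration would halve the constant, but only the
  quadratic order matters.\<close>

lemma F_linearization: "norm (F b - F a - J a *v (b - a)) \<le> C * (norm (b - a))\<^sup>2"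
proof -
  have "norm (F b - F a - J a *v (b - a)) \<le> norm (b - a) * (C * norm (b - a))"
  proof (rule differentiable_bound_linearization[where S = "cball a (norm (b - a))" and f' = "\<lambda>u h. J u *v h"])
    show "a + t *\<^sub>R (b - a) \<in> cball a (norm (b - a))" if "t \<in> {0..1}" for t
      using that by (simp add: dist_norm mult_left_le_one_le)
    show "(F has_derivative (*v) (J u)) (at u within cball a (norm (b - a)))" for u
      by (rule has_derivative_at_withinI[OF F_deriv])
    fix u assume "u \<in> cball a (norm (b - a))"
    then have u: "norm (u - a) \<le> norm (b - a)"
      by (simp add: dist_norm norm_minus_commute)
    show "onorm ((*v) (J u) - (*v) (J a)) \<le> C * norm (b - a)"
    proof (rule onorm_le)
      fix h
      have "norm (J u *v h - J a *v h) \<le> C * norm (u - a) * norm h"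
        by (rule J_lipschitz)
      also have "\<dots> \<le> C * norm (b - a) * norm h"
        using u C_pos by (intro mult_right_mono mult_left_mono) auto
      finally show "norm (((*v) (J u) - (*v) (J a)) h) \<le> C * norm (b - a) * norm h"
        by simp
    qed
  qed auto
  then show ?thesis
    by (simp add: power2_eq_square algebra_simps)
qed

text \<open>Along a segment between two points of one fibre, \<open>J w *v (b - a)\<close> is of second order.\<close>

lemma geodesic_dist_le_square:
  assumes h: "\<And>u v. u \<in> S \<Longrightarrow> v \<bullet> (Q (F u) *v v) \<le> h * (norm v)\<^sup>2"
    and S: "convex S" "a \<in> S" "b \<in> S" and eq: "F a = F b" and "0 \<le> h"
  shows "geodesic_dist G a b \<le> 2 * sqrt h * C * (norm (b - a))\<^sup>2"
proof -
  let ?\<gamma> = "\<lambda>t. a + t *\<^sub>R (b - a)"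
  let ?k = "\<lambda>t. sqrt ((b - a) \<bullet> (G (?\<gamma> t) *v (b - a)))"
  have "geodesic_dist G a b \<le> curve_length G ?\<gamma>"
    by (intro geodesic_dist_le C1_curve_linepath) auto
  also have "\<dots> = integral {0..1} ?k"
    by (rule C1_curve_linepath)
  also have "\<dots> \<le> integral {0..1} (\<lambda>t::real. 2 * sqrt h * C * (norm (b - a))\<^sup>2)"
  proof (rule integral_le)
    show "?k integrable_on {0..1}"
      by (intro integrable_continuous_real continuous_intros continuous_on_compose2[OF continuous]) auto
    fix t :: real assume t: "t \<in> {0..1}"
    have "?\<gamma> t = (1 - t) *\<^sub>R a + t *\<^sub>R b"
      by (simp add: algebra_simps)
    then have "?\<gamma> t \<in> S"
      using S t by (simp add: convex_def)
    \<comment> \<open>Since F a = F b, the last bracket is just - J a (b - a). Two errors of second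
      order remain, each at most C norm (b - a)^2; hence the factor 2.\<close>
    have "J (?\<gamma> t) *v (b - a) = (J (?\<gamma> t) *v (b - a) - J a *v (b - a)) - (F b - F a - J a *v (b - a))"
      by (simp add: eq)
    then have "norm (J (?\<gamma> t) *v (b - a)) \<le> norm (J (?\<gamma> t) *v (b - a) - J a *v (b - a)) + norm (F b - F a - J a *v (b - a))"
      by (metis norm_triangle_ineq4)
    also have "\<dots> \<le> C * norm (?\<gamma> t - a) * norm (b - a) + C * (norm (b - a))\<^sup>2"
      by (intro add_mono J_lipschitz F_linearization)
    also have "\<dots> \<le> C * norm (b - a) * norm (b - a) + C * (norm (b - a))\<^sup>2"
      using t C_pos by (intro add_mono mult_right_mono mult_left_mono) (auto simp: mult_left_le_one_le)
    finally have J: "norm (J (?\<gamma> t) *v (b - a)) \<le> 2 * C * (norm (b - a))\<^sup>2"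
      by (simp add: power2_eq_square)
    have "?k t \<le> sqrt (h * (norm (J (?\<gamma> t) *v (b - a)))\<^sup>2)"
      unfolding inner_G using h[OF \<open>?\<gamma> t \<in> S\<close>] by (intro real_sqrt_le_mono)
    also have "\<dots> = sqrt h * norm (J (?\<gamma> t) *v (b - a))"
      by (simp add: real_sqrt_mult)
    also have "\<dots> \<le> sqrt h * (2 * C * (norm (b - a))\<^sup>2)"
      using J \<open>0 \<le> h\<close> by (intro mult_left_mono) auto
    finally show "?k t \<le> 2 * sqrt h * C * (norm (b - a))\<^sup>2"
      by (simp add: mult_ac)
  qed auto
  finally show ?thesis
    by simp
qed

text \<open>Compactness of the unit ball about \<open>p\<close> bounds the weight, and its convexity
  keeps the segment where that bound holds.\<close>

lemma geodesic_dist_locally_le_square: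
  obtains M where "\<And>a b. a \<in> cball p 1 \<Longrightarrow> b \<in> cball p 1 \<Longrightarrow> F a = F b \<Longrightarrow>
    geodesic_dist G a b \<le> M * (norm (b - a))\<^sup>2"
proof -
  have c: "continuous_on (cball p 1) (\<lambda>u. Q (F u))"
    by (intro continuous_on_compose2[OF Q_continuous] F_continuous) auto
  obtain h where h: "0 < h" "\<forall>u\<in>cball p 1. \<forall>v. v \<bullet> (Q (F u) *v v) \<le> h * (norm v)\<^sup>2"
    by (rule pos_def_uniform_bounds[OF compact_cball c Q_pos_def]) (rule that)
  show ?thesis
  proof (rule that[of "2 * sqrt h * C"])
    fix a b assume "a \<in> cball p 1" "b \<in> cball p 1" "F a = F b"
    then show "geodesic_dist G a b \<le> 2 * sqrt h * C * (norm (b - a))\<^sup>2"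
      by (intro geodesic_dist_le_square[OF h(2)[rule_format] convex_cball]) (use h(1) in auto)
  qed
qed

lemma geodesic_dist_fibre_path:
  fixes \<gamma> :: "real \<Rightarrow> real^'d"
  assumes \<gamma>: "\<gamma> piecewise_differentiable_on {0..1}"
    and const: "\<And>t. t \<in> {0..1} \<Longrightarrow> F (\<gamma> t) = F (\<gamma> 0)"
  shows "geodesic_dist G (\<gamma> 0) (\<gamma> 1) = 0"
proof -
  have "geodesic_dist G (\<gamma> 0) (\<gamma> 1) = geodesic_dist G (\<gamma> 0) (\<gamma> 0)"
  proof (rule constant_along_piecewise_differentiable[where D = "\<lambda>s. geodesic_dist G (\<gamma> 0) (\<gamma> s)", OF \<gamma>])
    fix t :: real assume t: "t \<in> {0..1}"
    obtain M where M: "\<And>a b. a \<in> cball (\<gamma> t) 1 \<Longrightarrow> b \<in> cball (\<gamma> t) 1 \<Longrightarrow> F a = F b \<Longrightarrow>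
        geodesic_dist G a b \<le> M * (norm (b - a))\<^sup>2"
      using geodesic_dist_locally_le_square by blast
    have "(\<gamma> \<longlongrightarrow> \<gamma> t) (at t within {0..1})"
      using \<gamma> t by (auto simp: piecewise_differentiable_on_def continuous_on_def)
    then have "\<forall>\<^sub>F s in at t within {0..1}. dist (\<gamma> s) (\<gamma> t) < 1"
      by (rule tendstoD) simp
    moreover have "\<forall>\<^sub>F s in at t within {0..1}. s \<in> {0..1}"
      by (simp add: eventually_at_filter)
    ultimately have "\<forall>\<^sub>F s in at t within {0..1}.
        \<bar>geodesic_dist G (\<gamma> 0) (\<gamma> s) - geodesic_dist G (\<gamma> 0) (\<gamma> t)\<bar> \<le> M * (norm (\<gamma> s - \<gamma> t))\<^sup>2"
    proof eventually_elim
      case (elim s)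
      have "F (\<gamma> s) = F (\<gamma> t)"
        using const[of s] const[of t] elim t by simp
      moreover have "\<gamma> s \<in> cball (\<gamma> t) 1" "\<gamma> t \<in> cball (\<gamma> t) 1"
        using elim by (auto simp: dist_commute)
      \<comment> \<open>Both orders of the pair are bounded, one for each of the two triangle
        inequalities that follow.\<close>
      ultimately have "geodesic_dist G (\<gamma> s) (\<gamma> t) \<le> M * (norm (\<gamma> s - \<gamma> t))\<^sup>2"
        "geodesic_dist G (\<gamma> t) (\<gamma> s) \<le> M * (norm (\<gamma> s - \<gamma> t))\<^sup>2"
        using M[of "\<gamma> s" "\<gamma> t"] M[of "\<gamma> t" "\<gamma> s"] by (simp_all add: norm_minus_commute)
      then show ?case
        using geodesic_dist_triangle[of "\<gamma> 0" "\<gamma> s" "\<gamma> t"] geodesic_dist_triangle[of "\<gamma> 0" "\<gamma> t" "\<gamma> s"]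
        by linarith
    qed
    then show "\<exists>M. \<forall>\<^sub>F s in at t within {0..1}.
        \<bar>geodesic_dist G (\<gamma> 0) (\<gamma> s) - geodesic_dist G (\<gamma> 0) (\<gamma> t)\<bar> \<le> M * (norm (\<gamma> s - \<gamma> t))\<^sup>2"
      by blast
  qed simp
  then show ?thesis
    by (simp add: geodesic_dist_refl)
qed

section \<open>Right inverses of the Jacobian and charts of uniform size\<close>

text \<open>With \<open>S = matrix_sqrt (Q (F w))\<close>, a right inverse of \<open>J w\<close> is
  \<open>transpose (J w) ** S ** inverse NTK ** S\<close>.\<close>

lemma J_right_inverse:
  assumes h: "\<And>v. v \<bullet> (Q (F w) *v v) \<le> h * (norm v)\<^sup>2" "0 \<le> h"
  obtains R where "linear R" "\<And>v. J w *v R v = v" "\<And>v. norm (R v) \<le> sqrt L * sqrt h / l * norm v"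
proof -
  define S where "S = matrix_sqrt (Q (F w))"
  define N where "N = S ** J w ** transpose (J w) ** S"
  have S: "pos_def S" "S ** S = Q (F w)"
    using matrix_sqrt_pos_def[OF Q_pos_def] by (simp_all add: S_def)
  have Ssym: "(S *v u) \<bullet> v = u \<bullet> (S *v v)" for u v
    using S(1) by (intro symmetric_matrix_inner) (simp add: pos_def_def)
  have N: "l * norm v \<le> norm (N *v v)" "norm (N *v v) \<le> L * norm v" for v
    using NTK_lower NTK_upper by (simp_all add: N_def S_def)
  have "v = 0" if "N *v v = 0" for v
    using N(1)[of v] that l_pos by (simp add: mult_le_0_iff)
  then have inj: "inj ((*v) N)"
    by (simp add: linear_injective_0)
  obtain g where g: "linear g" "\<And>v. N *v g v = v"
    using linear_injective_isomorphism[OF matrix_vector_mul_linear inj] by blast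
  have Seq: "u = v" if "S *v u = S *v v" for u v
  proof -
    have "S *v (u - v) = 0"
      using that by (simp add: matrix_vector_mult_diff_distrib)
    then have "(u - v) \<bullet> (S *v (u - v)) = 0"
      by simp
    then have "u - v = 0"
      using S(1) unfolding pos_def_def by (metis less_irrefl)
    then show ?thesis
      by simp
  qed
  define R where "R v = transpose (J w) *v (S *v g (S *v v))" for v
  show ?thesis
  proof
    have "R = (*v) (transpose (J w)) \<circ> ((*v) S \<circ> (g \<circ> (*v) S))"
      by (auto simp: R_def)
    then show "linear R"
      by (auto intro!: linear_compose g)
    show "J w *v R v = v" for v
    proof (rule Seq)
      have "S *v (J w *v R v) = N *v g (S *v v)"
        unfolding R_def N_def matrix_vector_mul_assoc[symmetric] ..
      then show "S *v (J w *v R v) = S *v v"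
        by (simp add: g)
    qed
    fix v
    let ?u = "g (S *v v)"
    have "(norm (S *v v))\<^sup>2 = v \<bullet> (Q (F w) *v v)"
      unfolding S(2)[symmetric] matrix_vector_mul_assoc[symmetric] by (simp add: power2_norm_eq_inner Ssym)
    also have "\<dots> \<le> (sqrt h * norm v)\<^sup>2"
      using h by (simp add: power_mult_distrib)
    finally have Sv: "norm (S *v v) \<le> sqrt h * norm v"
      by (rule power2_le_imp_le) (use h(2) in simp)
    have "l * norm ?u \<le> norm (S *v v)"
      using N(1)[of ?u] by (simp add: g)
    then have u: "norm ?u \<le> sqrt h * norm v / l"
      using Sv l_pos by (simp add: field_simps)
    \<comment> \<open>With S = \<open>matrix_sqrt (Q (F w))\<close>, R v is the transpose of J
      applied to S u, so its squared norm is the form of the NTK at u. Thus \<open>L\<close>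
      controls R without a separate bound on J, and u, the NTK inverse of S v, is controlled by
      \<open>l\<close>.\<close>
    have "(norm (R v))\<^sup>2 = ?u \<bullet> (N *v ?u)"
      unfolding R_def N_def matrix_vector_mul_assoc[symmetric] power2_norm_eq_inner
      by (simp only: Ssym inner_transpose_matrix_left)
    also have "\<dots> \<le> norm ?u * (L * norm ?u)"
      by (intro order_trans[OF norm_cauchy_schwarz] mult_left_mono N) auto
    also have "\<dots> = (sqrt L * norm ?u)\<^sup>2"
      using L_nonneg by (simp add: power_mult_distrib power2_eq_square)
    finally have "norm (R v) \<le> sqrt L * norm ?u"
      by (rule power2_le_imp_le) (use L_nonneg in simp)
    also have "\<dots> \<le> sqrt L * (sqrt h * norm v / l)"
      using u L_nonneg by (intro mult_left_mono) auto
    finally show "norm (R v) \<le> sqrt L * sqrt h / l * norm v"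
      by simp
  qed
qed

text \<open>Although the parameters concerned may form an unbounded set, \<open>h\<close> comes from
  a compact ball of outputs and \<open>l\<close>, \<open>L\<close> are global.\<close>

lemma J_right_inverse_uniform:
  obtains K where "0 < K"
    "\<And>w. F w \<in> cball z 1 \<Longrightarrow> \<exists>R. linear R \<and> (\<forall>v. J w *v R v = v) \<and> (\<forall>v. norm (R v) \<le> K * norm v)"
proof -
  have c: "continuous_on (cball z 1) Q"
    by (rule continuous_on_subset[OF Q_continuous]) simp
  obtain h where h: "0 < h" "\<forall>z'\<in>cball z 1. \<forall>v. v \<bullet> (Q z' *v v) \<le> h * (norm v)\<^sup>2"
    by (rule pos_def_uniform_bounds[OF compact_cball c Q_pos_def]) (rule that)
  let ?K = "sqrt L * sqrt h / l"
  have K: "?K * norm v \<le> (?K + 1) * norm v" for v :: "real^'m"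
    by (simp add: distrib_right)
  show ?thesis
  proof
    \<comment> \<open>The summand 1 gives strict positivity from \<open>L_nonneg\<close>
      alone.\<close>
    show "0 < ?K + 1"
      using h L_nonneg l_pos by (intro add_nonneg_pos) auto
    fix w assume w: "F w \<in> cball z 1"
    obtain R where "linear R" "\<And>v. J w *v R v = v" "\<And>v. norm (R v) \<le> ?K * norm v"
      by (rule J_right_inverse[OF h(2)[rule_format, OF w] less_imp_le[OF h(1)]]) (rule that)
    then show "\<exists>R. linear R \<and> (\<forall>v. J w *v R v = v) \<and> (\<forall>v. norm (R v) \<le> (?K + 1) * norm v)"
      using order_trans[OF _ K] by blast
  qed
qed

text \<open>The chart \<open>\<Psi>\<close> is \<open>u \<mapsto> (I - R J) (u - w) + R (F u - F w)\<close>: its derivative at \<open>w\<close> is the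
  identity, and \<open>J w *v \<Psi> u = F u - F w\<close> straightens the fibres of \<open>F\<close> on a ball whose radius
  depends only on \<open>z\<close>.\<close>

lemma fibre_chart:
  obtains K \<rho> where "0 < K" "0 < \<rho>"
    "\<And>w. F w \<in> cball z 1 \<Longrightarrow> \<exists>R \<Psi> g. \<Psi> w = 0 \<and> (\<forall>u. J w *v \<Psi> u = F u - F w) \<and>
      (\<forall>v. J w *v R v = v) \<and> (\<forall>v. norm (R v) \<le> K * norm v) \<and>
      (\<forall>y\<in>cball 0 \<rho>. \<Psi> (g y) = y \<and> norm (g y - w) \<le> 2 * norm y) \<and>
      (\<forall>u\<in>cball w (\<rho> / 2). g (\<Psi> u) = u \<and> \<Psi> u \<in> ball 0 \<rho>) \<and>
      (\<forall>y\<in>ball 0 \<rho>. g differentiable (at y))"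
proof -
  obtain K where K: "0 < K"
    "\<And>w. F w \<in> cball z 1 \<Longrightarrow> \<exists>R. linear R \<and> (\<forall>v. J w *v R v = v) \<and> (\<forall>v. norm (R v) \<le> K * norm v)"
    using J_right_inverse_uniform by blast
  \<comment> \<open>Chosen so that K C r = 1/2: on a ball of radius \<open>r\<close> the derivative
    R (J u - J w) of \<Psi> minus the identity has norm at most 1/2.\<close>
  define r where "r = 1 / (2 * (K * C))"
  have r: "0 < r"
    using K C_pos by (simp add: r_def)
  show ?thesis
  proof (rule that[of K "r / 2"])
    show "0 < K" "0 < r / 2"
      using K r by simp_all
    fix w assume w: "F w \<in> cball z 1"
    obtain R where R: "linear R" "\<And>v. J w *v R v = v" "\<And>v. norm (R v) \<le> K * norm v"
      using K(2)[OF w] by blast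
    have R': "bounded_linear R"
      using R(1) by (simp add: linear_conv_bounded_linear)
    define \<Psi> where "\<Psi> u = (u - w) - R (J w *v (u - w)) + R (F u - F w)" for u
    have \<Psi>w: "\<Psi> w = 0"
      using linear_0[OF R(1)] by (simp add: \<Psi>_def)
    have d: "(\<Psi> has_derivative (\<lambda>h. h - R (J w *v h) + R (J u *v h))) (at u)" for u
    proof -
      have "((\<lambda>u. J w *v (u - w)) has_derivative (\<lambda>h. J w *v h)) (at u)"
        by (rule bounded_linear.has_derivative[OF matrix_vector_mul_bounded_linear])
          (auto intro!: derivative_eq_intros)
      moreover have "((\<lambda>u. F u - F w) has_derivative (\<lambda>h. J u *v h)) (at u)"
        using has_derivative_diff[OF F_deriv has_derivative_const] by simp
      ultimately show ?thesis
        unfolding \<Psi>_def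
        by (intro has_derivative_add has_derivative_diff bounded_linear.has_derivative[OF R'])
          (auto intro!: derivative_eq_intros)
    qed
    have near: "norm (h - R (J w *v h) + R (J u *v h) - h) \<le> norm h / 2" if "u \<in> cball w r" for u h
    proof -
      have "h - R (J w *v h) + R (J u *v h) - h = R (J u *v h - J w *v h)"
        by (simp add: linear_diff[OF R(1)])
      then have "norm (h - R (J w *v h) + R (J u *v h) - h) \<le> K * norm (J u *v h - J w *v h)"
        by (simp only: R(3))
      also have "\<dots> \<le> K * (C * r * norm h)"
        using that K(1) C_pos
        by (intro mult_left_mono order_trans[OF J_lipschitz] mult_right_mono) (auto simp: dist_norm norm_minus_commute)
      also have "\<dots> = norm h / 2"
        using K(1) C_pos by (simp add: r_def)
      finally show ?thesis .
    qed
    obtain g where g: "\<And>y. y \<in> cball 0 (r / 2) \<Longrightarrow> \<Psi> (g y) = y"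
      "\<And>u. u \<in> cball w r \<Longrightarrow> \<Psi> u \<in> cball 0 (r / 2) \<Longrightarrow> g (\<Psi> u) = u"
      "\<And>y. y \<in> cball 0 (r / 2) \<Longrightarrow> norm (g y - w) \<le> 2 * norm y"
      "\<And>y. y \<in> ball 0 (r / 2) \<Longrightarrow> g differentiable (at y)"
      "\<And>u. u \<in> cball w r \<Longrightarrow> norm (\<Psi> u) \<le> 3 / 2 * norm (u - w)"
      by (rule local_inverse_near_identity[of w r \<Psi>, OF d near less_imp_le[OF r], unfolded \<Psi>w diff_zero])
        (assumption, rule that)
    \<comment> \<open>Since 3/2 times r/4 is below r/2, \<Psi> maps this smaller ball into the open
      ball, where \<open>g\<close> is differentiable.\<close>
    have u: "g (\<Psi> u) = u \<and> \<Psi> u \<in> ball 0 (r / 2)" if "u \<in> cball w (r / 2 / 2)" for u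
    proof -
      have u: "u \<in> cball w r" "norm (u - w) \<le> r / 4"
        using that r by (auto simp: dist_norm norm_minus_commute)
      then have "norm (\<Psi> u) < r / 2"
        using g(5)[OF u(1)] r by linarith
      then show ?thesis
        using g(2)[OF u(1)] by simp
    qed
    \<comment> \<open>J R = I makes J annihilate (I - R J) (u - w) and leaves F u - F w.\<close>
    have J\<Psi>: "J w *v \<Psi> u = F u - F w" for u
      by (simp add: \<Psi>_def matrix_vector_right_distrib matrix_vector_mult_diff_distrib R(2))
    show "\<exists>R \<Psi> g. \<Psi> w = 0 \<and> (\<forall>u. J w *v \<Psi> u = F u - F w) \<and>
      (\<forall>v. J w *v R v = v) \<and> (\<forall>v. norm (R v) \<le> K * norm v) \<and>
      (\<forall>y\<in>cball 0 (r / 2). \<Psi> (g y) = y \<and> norm (g y - w) \<le> 2 * norm y) \<and>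
      (\<forall>u\<in>cball w (r / 2 / 2). g (\<Psi> u) = u \<and> \<Psi> u \<in> ball 0 (r / 2)) \<and>
      (\<forall>y\<in>ball 0 (r / 2). g differentiable (at y))"
      using \<Psi>w J\<Psi> R(2,3) g(1,3,4) u by (intro exI[of _ R] exI[of _ \<Psi>] exI[of _ g] conjI) auto
  qed
qed

text \<open>\<open>reparam_rel\<close> expects a network with an input; here the input is a dummy.\<close>

abbreviation fibre_rel :: "((real^'d) \<times> (real^'d)) set" where
  "fibre_rel \<equiv> reparam_rel (\<lambda>w (_::real^1). F w) UNIV"

text \<open>In the chart at \<open>w\<close> a point of the fibre over \<open>z\<close> is found by
  solving a linear equation with R. In the chart at \<open>p\<close> the fibre is the kernel of
  \<open>J p\<close>, so a straight segment in chart coordinates joins \<open>p\<close> to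
  \<open>q\<close> inside it. The constants depend on \<open>z\<close> only.\<close>

lemma fibre_neighbourhood:
  obtains K \<rho> where "0 < K" "0 < \<rho>"
    "\<And>w. F w \<in> cball z 1 \<Longrightarrow> K * norm (F w - z) \<le> \<rho> \<Longrightarrow> \<exists>p. F p = z \<and> norm (p - w) \<le> 2 * K * norm (F w - z)"
    "\<And>p q. F p = z \<Longrightarrow> F q = z \<Longrightarrow> norm (q - p) \<le> \<rho> / 2 \<Longrightarrow> (p, q) \<in> fibre_rel"
proof -
  obtain K \<rho> where K: "0 < K" "0 < \<rho>" and
    chart: "\<And>w. F w \<in> cball z 1 \<Longrightarrow> \<exists>R \<Psi> g. \<Psi> w = 0 \<and> (\<forall>u. J w *v \<Psi> u = F u - F w) \<and>
      (\<forall>v. J w *v R v = v) \<and> (\<forall>v. norm (R v) \<le> K * norm v) \<and>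
      (\<forall>y\<in>cball 0 \<rho>. \<Psi> (g y) = y \<and> norm (g y - w) \<le> 2 * norm y) \<and>
      (\<forall>u\<in>cball w (\<rho> / 2). g (\<Psi> u) = u \<and> \<Psi> u \<in> ball 0 \<rho>) \<and>
      (\<forall>y\<in>ball 0 \<rho>. g differentiable (at y))"
    by (rule fibre_chart) (rule that)
  show ?thesis
  proof (rule that[OF K])
    fix w assume w: "F w \<in> cball z 1" and small: "K * norm (F w - z) \<le> \<rho>"
    obtain R \<Psi> g where J\<Psi>: "\<forall>u. J w *v \<Psi> u = F u - F w"
      and R: "\<forall>v. J w *v R v = v" "\<forall>v. norm (R v) \<le> K * norm v"
      and g: "\<forall>y\<in>cball 0 \<rho>. \<Psi> (g y) = y \<and> norm (g y - w) \<le> 2 * norm y"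
      using chart[OF w] by (elim exE conjE)
    \<comment> \<open>J w maps this \<open>y\<close> to z - F w, the change of output that is
      wanted; \<open>small\<close> keeps it in the domain of \<open>g\<close>.\<close>
    define y where "y = R (z - F w)"
    have ny: "norm y \<le> K * norm (F w - z)"
      using R(2) unfolding y_def by (metis norm_minus_commute)
    then have y: "y \<in> cball 0 \<rho>"
      using small by simp
    have "F (g y) - F w = J w *v \<Psi> (g y)"
      using J\<Psi> by simp
    also have "\<dots> = z - F w"
      using g y R(1) by (simp add: y_def)
    finally have "F (g y) = z"
      by simp
    moreover have "norm (g y - w) \<le> 2 * K * norm (F w - z)"
      using g y ny by fastforce
    ultimately show "\<exists>p. F p = z \<and> norm (p - w) \<le> 2 * K * norm (F w - z)"
      by blast
  next
    fix p q assume p: "F p = z" and q: "F q = z" and close: "norm (q - p) \<le> \<rho> / 2"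
    have "F p \<in> cball z 1"
      by (simp add: p)
    then obtain R \<Psi> g where \<Psi>p: "\<Psi> p = 0" and J\<Psi>: "\<forall>u. J p *v \<Psi> u = F u - F p"
      and g1: "\<forall>y\<in>cball 0 \<rho>. \<Psi> (g y) = y \<and> norm (g y - p) \<le> 2 * norm y"
      and g2: "\<forall>u\<in>cball p (\<rho> / 2). g (\<Psi> u) = u \<and> \<Psi> u \<in> ball 0 \<rho>"
      and g3: "\<forall>y\<in>ball 0 \<rho>. g differentiable (at y)"
      by (drule_tac chart) (elim exE conjE)
    have "q \<in> cball p (\<rho> / 2)" "p \<in> cball p (\<rho> / 2)"
      using close K by (simp_all add: dist_norm norm_minus_commute)
    then have "g (\<Psi> q) = q \<and> \<Psi> q \<in> ball 0 \<rho>" "g (\<Psi> p) = p"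
      using g2 by blast+
    then have gq: "g (\<Psi> q) = q" "norm (\<Psi> q) < \<rho>" and gp: "g 0 = p"
      by (simp_all add: \<Psi>p)
    \<comment> \<open>As F q = F p, the vector \<Psi> q lies in the kernel of \<open>J p\<close>,
      and so do all its multiples.\<close>
    define \<gamma> where "\<gamma> = (\<lambda>t::real. g (t *\<^sub>R \<Psi> q))"
    have in_ball: "t *\<^sub>R \<Psi> q \<in> ball 0 \<rho>" if "t \<in> {0..1}" for t
      using that gq(2) mult_left_le_one_le[of "norm (\<Psi> q)" t] by simp
    show "(p, q) \<in> fibre_rel"
    proof (rule reparam_relI)
      show "\<gamma> piecewise_differentiable_on {0..1}"
      proof (rule differentiable_imp_piecewise_differentiable)
        fix t :: real assume t: "t \<in> {0..1}"
        have "(\<lambda>t. t *\<^sub>R \<Psi> q) differentiable (at t within {0..1})"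
          by simp
        moreover have "g differentiable (at (t *\<^sub>R \<Psi> q) within (\<lambda>t. t *\<^sub>R \<Psi> q) ` {0..1})"
          using g3 in_ball[OF t] differentiable_at_withinI by blast
        ultimately have "g \<circ> (\<lambda>t. t *\<^sub>R \<Psi> q) differentiable (at t within {0..1})"
          by (rule differentiable_chain_within)
        then show "\<gamma> differentiable (at t within {0..1})"
          by (simp add: \<gamma>_def o_def)
      qed
      show "\<gamma> 0 = p" "\<gamma> 1 = q"
        by (simp_all add: \<gamma>_def gp gq)
      fix t :: real assume "t \<in> {0..1}"
      then have "\<Psi> (\<gamma> t) = t *\<^sub>R \<Psi> q"
        using in_ball[of t] g1 by (simp add: \<gamma>_def)
      then have "F (\<gamma> t) - F p = t *\<^sub>R (F q - F p)"
        using J\<Psi> by (metis matrix_vector_mult_scaleR)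
      then show "F (\<gamma> t) = F p"
        by (simp add: p q)
    qed
  qed
qed

section \<open>From short curves to paths in the fibre\<close>

text \<open>Bootstrap: while the image stays in the unit ball about \<open>z\<close>, its speed is
  at most the length integrand divided by \<open>sqrt m\<close>, so it moves less than \<delta>. As
  \<delta> \<le> 1, it cannot leave the region where \<open>m\<close> is valid; a first exit time
  makes this precise.\<close>

lemma F_image_stays_close:
  assumes m: "0 < m" "\<forall>z'\<in>cball z 1. \<forall>v. m * (norm v)\<^sup>2 \<le> v \<bullet> (Q z' *v v)"
    and \<gamma>: "C1_curve \<gamma>" "F (\<gamma> 0) = z" and len: "curve_length G \<gamma> < sqrt m * \<delta>" and \<delta>: "\<delta> \<le> 1"
    and t: "t \<in> {0..1}"
  shows "norm (F (\<gamma> t) - z) < \<delta>"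
proof -
  obtain \<gamma>' where \<gamma>': "\<And>t. t \<in> {0..1} \<Longrightarrow> (\<gamma> has_vector_derivative \<gamma>' t) (at t within {0..1})"
    "continuous_on {0..1} \<gamma>'" "continuous_on {0..1} \<gamma>"
    by (rule C1_curveE[OF \<gamma>(1)]) (rule that)
  define c where "c t = J (\<gamma> t) *v \<gamma>' t" for t
  define k where "k t = sqrt (\<gamma>' t \<bullet> (G (\<gamma> t) *v \<gamma>' t))" for t
  have len_k: "curve_length G \<gamma> = integral {0..1} k"
    unfolding k_def by (rule C1_curveI(2)[OF \<gamma>'(1,2)])
  have ck: "continuous_on {0..1} k"
    unfolding k_def by (intro continuous_intros continuous_on_compose2[OF continuous] \<gamma>') auto
  have cc: "continuous_on {0..1} c"
    unfolding c_def by (intro continuous_intros continuous_on_compose2[OF J_continuous] \<gamma>') auto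
  have cF: "continuous_on {0..1} (\<lambda>t. norm (F (\<gamma> t) - z))"
    using continuous_on_compose2[OF F_continuous[of UNIV] \<gamma>'(3)]
    by (intro continuous_intros) auto
  have Fd: "((F \<circ> \<gamma>) has_vector_derivative c t) (at t within {0..1})" if "t \<in> {0..1}" for t
    unfolding c_def
    by (rule vector_derivative_diff_chain_within[OF \<gamma>'(1)[OF that] has_derivative_at_withinI[OF F_deriv]])
  have k0: "0 \<le> k t" for t
    by (simp add: k_def nonneg)
  have ksqrt: "norm (c t) \<le> 1 / sqrt m * k t" if "norm (F (\<gamma> t) - z) \<le> 1" for t
  proof -
    have "F (\<gamma> t) \<in> cball z 1"
      using that by (simp add: dist_norm norm_minus_commute)
    then have "m * (norm (c t))\<^sup>2 \<le> c t \<bullet> (Q (F (\<gamma> t)) *v c t)"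
      using m(2) by blast
    then have "sqrt (m * (norm (c t))\<^sup>2) \<le> k t"
      unfolding k_def inner_G c_def by (rule real_sqrt_le_mono)
    then show ?thesis
      using m(1) by (simp add: real_sqrt_mult field_simps)
  qed
  have claim: "norm (F (\<gamma> T) - z) < \<delta>"
    if T: "T \<in> {0..1}" and le: "\<And>s. s \<in> {0..T} \<Longrightarrow> norm (F (\<gamma> s) - z) \<le> 1" for T
  proof -
    have sub: "{0..T} \<subseteq> {0..1}"
      using T by auto
    have "(c has_integral (F \<circ> \<gamma>) T - (F \<circ> \<gamma>) 0) {0..T}"
      using T sub
      by (intro fundamental_theorem_of_calculus has_vector_derivative_within_subset[OF Fd sub]) auto
    then have "norm (F (\<gamma> T) - z) = norm (integral {0..T} c)"
      using \<gamma>(2) by (simp add: integral_unique)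
    also have "\<dots> \<le> integral {0..T} (\<lambda>s. 1 / sqrt m * k s)"
      using le ksqrt
      by (intro integral_norm_bound_integral integrable_continuous_real continuous_intros
          continuous_on_subset[OF cc sub] continuous_on_subset[OF ck sub]) auto
    also have "\<dots> = 1 / sqrt m * integral {0..T} k"
      by (rule integral_mult_right)
    also have "\<dots> \<le> 1 / sqrt m * integral {0..1} k"
      using m(1) k0
      by (intro mult_left_mono integral_subset_le sub integrable_continuous_real ck
          continuous_on_subset[OF ck sub]) auto
    also have "\<dots> < 1 / sqrt m * (sqrt m * \<delta>)"
      using len m(1) unfolding len_k by (intro mult_strict_left_mono) auto
    finally show ?thesis
      using m(1) by simp
  qed
  have "0 \<le> curve_length G \<gamma>"
    by (rule curve_length_nonneg)
  then have \<delta>0: "0 < \<delta>"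
    using len m(1) by (smt (verit) real_sqrt_gt_zero zero_less_mult_iff)
  show ?thesis
  proof (rule ccontr)
    assume neg: "\<not> norm (F (\<gamma> t) - z) < \<delta>"
    define A where "A = {s \<in> {0..1}. \<delta> \<le> norm (F (\<gamma> s) - z)}"
    have "t \<in> A"
      using neg t by (simp add: A_def)
    have "closed A"
      unfolding A_def by (intro continuous_on_closed_Collect_le cF continuous_intros)
    moreover have "bounded A"
      by (rule bounded_subset[OF bounded_closed_interval[of 0 1]]) (auto simp: A_def)
    ultimately have "compact A"
      by (simp add: compact_eq_bounded_closed)
    then obtain T where T: "T \<in> A" "\<And>s. s \<in> A \<Longrightarrow> T \<le> s"
      using compact_attains_inf[of A] \<open>t \<in> A\<close> by blast
    have T01: "T \<in> {0..1}" and T\<delta>: "\<delta> \<le> norm (F (\<gamma> T) - z)"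
      using T by (simp_all add: A_def)
    \<comment> \<open>Minimality of \<open>T\<close> only controls earlier times; by the
      intermediate value theorem the distance at \<open>T\<close> is exactly \<delta>, so
      \<open>claim\<close> applies on the closed interval up to \<open>T\<close>.\<close>
    have "\<exists>s\<ge>0. s \<le> T \<and> norm (F (\<gamma> s) - z) = \<delta>"
      using T01 T\<delta> \<delta>0 \<gamma>(2)
      by (intro IVT' continuous_on_subset[OF cF]) auto
    then obtain s where s: "0 \<le> s" "s \<le> T" "norm (F (\<gamma> s) - z) = \<delta>"
      by blast
    then have "s \<in> A"
      using T01 by (simp add: A_def)
    then have "T = s"
      using T(2) s by fastforce
    with s have FT: "norm (F (\<gamma> T) - z) = \<delta>"
      by simp
    have "norm (F (\<gamma> s) - z) \<le> 1" if "s \<in> {0..T}" for s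
    proof (cases "s \<in> A")
      case True
      then show ?thesis
        using T(2)[of s] that FT \<delta> by auto
    next
      case False
      then show ?thesis
        using that T01 \<delta> by (auto simp: A_def)
    qed
    then have "norm (F (\<gamma> T) - z) < \<delta>"
      by (rule claim[OF T01])
    then show False
      using T\<delta> by simp
  qed
qed

lemma fibre_rel_if_geodesic_dist_zero:
  assumes "geodesic_dist G w0 w1 = 0"
  shows "(w0, w1) \<in> fibre_rel"
proof -
  define z where "z = F w0"
  have c: "continuous_on (cball z 1) Q"
    by (rule continuous_on_subset[OF Q_continuous]) simp
  obtain m where m: "0 < m" "\<forall>z'\<in>cball z 1. \<forall>v. m * (norm v)\<^sup>2 \<le> v \<bullet> (Q z' *v v)"
    by (rule pos_def_uniform_bounds[OF compact_cball c Q_pos_def]) (rule that)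
  obtain K \<rho> where K: "0 < K" "0 < \<rho>" and
    proj: "\<And>w. F w \<in> cball z 1 \<Longrightarrow> K * norm (F w - z) \<le> \<rho> \<Longrightarrow> \<exists>p. F p = z \<and> norm (p - w) \<le> 2 * K * norm (F w - z)" and
    link: "\<And>p q. F p = z \<Longrightarrow> F q = z \<Longrightarrow> norm (q - p) \<le> \<rho> / 2 \<Longrightarrow> (p, q) \<in> fibre_rel"
    by (rule fibre_neighbourhood) (rule that)
  have near_curve: "\<exists>\<gamma>. C1_curve \<gamma> \<and> \<gamma> 0 = w0 \<and> \<gamma> 1 = w1 \<and> (\<forall>t\<in>{0..1}. norm (F (\<gamma> t) - z) < \<delta>)"
    if "0 < \<delta>" "\<delta> \<le> 1" for \<delta>
  proof -
    have "geodesic_dist G w0 w1 < sqrt m * \<delta>"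
      using assms m(1) that(1) by simp
    then obtain \<gamma> where "C1_curve \<gamma>" "\<gamma> 0 = w0" "\<gamma> 1 = w1" "curve_length G \<gamma> < sqrt m * \<delta>"
      by (rule geodesic_dist_lessE)
    then show ?thesis
      using F_image_stays_close[OF m] that(2) unfolding z_def by blast
  qed
  \<comment> \<open>If the outputs differed, a curve whose image stays within their distance of
    \<open>z\<close> could not end at \<open>w1\<close>.\<close>
  have Fw1: "F w1 = z"
  proof (rule ccontr)
    assume "F w1 \<noteq> z"
    then obtain \<gamma> :: "real \<Rightarrow> real^'d" where \<gamma>: "\<gamma> 1 = w1"
      "\<forall>t\<in>{0..1}. norm (F (\<gamma> t) - z) < min 1 (norm (F w1 - z))"
      using near_curve[of "min 1 (norm (F w1 - z))"] by auto
    have "norm (F (\<gamma> 1) - z) < min 1 (norm (F w1 - z))"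
      using \<gamma>(2) by (rule bspec) simp
    then have "norm (F w1 - z) < min 1 (norm (F w1 - z))"
      by (simp only: \<gamma>(1))
    then show False
      by simp
  qed
  \<comment> \<open>A projection then moves a point by at most 2 K \<delta> \<le> \<rho> / 8. Two
    projections and a step of length \<rho> / 4 along the curve add up to \<rho> / 2, the range of
    \<open>link\<close>.\<close>
  define \<delta> where "\<delta> = min 1 (\<rho> / (16 * K))"
  have \<delta>: "0 < \<delta>" "\<delta> \<le> 1" "K * \<delta> \<le> \<rho> / 16"
  proof -
    have "K * \<delta> \<le> K * (\<rho> / (16 * K))"
      unfolding \<delta>_def using K by (intro mult_left_mono) auto
    then show "K * \<delta> \<le> \<rho> / 16"
      using K by simp
  qed (use K in \<open>auto simp: \<delta>_def\<close>)
  obtain \<gamma> where \<gamma>: "C1_curve \<gamma>" "\<gamma> 0 = w0" "\<gamma> 1 = w1"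
    and F\<gamma>: "\<forall>t\<in>{0..1}. norm (F (\<gamma> t) - z) < \<delta>"
    using near_curve[OF \<delta>(1,2)] by blast
  \<comment> \<open>The endpoints lie in the fibre already and are their own projections, so the
    chain starts at \<open>w0\<close> and ends at \<open>w1\<close>.\<close>
  have "\<exists>p. F p = z \<and> norm (p - \<gamma> t) \<le> \<rho> / 8 \<and> (t = 0 \<longrightarrow> p = w0) \<and> (t = 1 \<longrightarrow> p = w1)"
    if t: "t \<in> {0..1}" for t
  proof (cases "t = 0 \<or> t = 1")
    case True
    then show ?thesis
      using \<gamma> K Fw1 by (auto simp: z_def)
  next
    case False
    have Ft: "norm (F (\<gamma> t) - z) < \<delta>"
      using F\<gamma> t by blast
    have KF: "K * norm (F (\<gamma> t) - z) \<le> \<rho> / 16"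
      using Ft K(1) \<delta>(3) mult_left_mono[of "norm (F (\<gamma> t) - z)" \<delta> K] by linarith
    have "F (\<gamma> t) \<in> cball z 1"
      using Ft \<delta>(2) by (simp add: dist_norm norm_minus_commute)
    moreover have "K * norm (F (\<gamma> t) - z) \<le> \<rho>"
      using KF K(2) by linarith
    ultimately obtain p where "F p = z" "norm (p - \<gamma> t) \<le> 2 * K * norm (F (\<gamma> t) - z)"
      using proj by blast
    moreover have "2 * K * norm (F (\<gamma> t) - z) \<le> \<rho> / 8"
      using KF by linarith
    ultimately show ?thesis
      using False by fastforce
  qed
  then have "\<forall>t\<in>{0..1}. \<exists>p. F p = z \<and> norm (p - \<gamma> t) \<le> \<rho> / 8 \<and> (t = 0 \<longrightarrow> p = w0) \<and> (t = 1 \<longrightarrow> p = w1)"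
    by blast
  from bchoice[OF this] obtain \<pi> where
    \<pi>: "\<forall>t\<in>{0..1}. F (\<pi> t) = z \<and> norm (\<pi> t - \<gamma> t) \<le> \<rho> / 8 \<and> (t = 0 \<longrightarrow> \<pi> t = w0) \<and> (t = 1 \<longrightarrow> \<pi> t = w1)"
    by blast
  have equiv: "equiv UNIV fibre_rel"
    by (rule equiv_reparam_rel)
  have "(\<pi> 0, \<pi> 1) \<in> fibre_rel"
  \<comment> \<open>Continuity of \<open>\<gamma>\<close> makes nearby times related; connectedness
    spreads this over the interval in place of an explicit subdivision.\<close>
  proof (rule connected_equivalence_relation[where S = "{0..1}" and R = "\<lambda>s t. (\<pi> s, \<pi> t) \<in> fibre_rel"])
    show "(\<pi> t, \<pi> s) \<in> fibre_rel" if "(\<pi> s, \<pi> t) \<in> fibre_rel" for s t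
      using equiv that by (auto elim: equivE dest: symD)
    show "(\<pi> s, \<pi> u) \<in> fibre_rel" if "(\<pi> s, \<pi> t) \<in> fibre_rel" "(\<pi> t, \<pi> u) \<in> fibre_rel" for s t u
      using equiv that by (meson equivE transD)
    fix t :: real assume t: "t \<in> {0..1}"
    have c\<gamma>: "continuous_on {0..1} \<gamma>"
      using C1_curveE[OF \<gamma>(1)] by blast
    let ?T = "{0..1} \<inter> \<gamma> -` ball (\<gamma> t) (\<rho> / 4)"
    have "openin (top_of_set {0..1}) ?T"
      by (rule continuous_openin_preimage_gen[OF c\<gamma> open_ball])
    moreover have "t \<in> ?T"
      using t K by simp
    moreover have "(\<pi> t, \<pi> s) \<in> fibre_rel" if "s \<in> ?T" for s
    proof (rule link)
      have s: "s \<in> {0..1}" "norm (\<gamma> s - \<gamma> t) < \<rho> / 4"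
        using that by (auto simp: dist_norm norm_minus_commute)
      show "F (\<pi> t) = z" "F (\<pi> s) = z"
        using \<pi> s t by blast+
      have "norm (\<pi> s - \<pi> t) \<le> norm (\<pi> s - \<gamma> s) + norm (\<gamma> s - \<gamma> t) + norm (\<pi> t - \<gamma> t)"
        using dist_triangle[of "\<pi> s" "\<pi> t" "\<gamma> s"] dist_triangle[of "\<gamma> s" "\<pi> t" "\<gamma> t"]
        unfolding dist_norm[symmetric] by (simp add: dist_commute)
      moreover have "norm (\<pi> s - \<gamma> s) \<le> \<rho> / 8" "norm (\<pi> t - \<gamma> t) \<le> \<rho> / 8"
        using \<pi> s t by blast+
      ultimately show "norm (\<pi> s - \<pi> t) \<le> \<rho> / 2"
        using s(2) by linarith
    qed
    ultimately show "\<exists>T. openin (top_of_set {0..1}) T \<and> t \<in> T \<and> (\<forall>s\<in>T. (\<pi> t, \<pi> s) \<in> fibre_rel)"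
      by blast
  qed auto
  then show ?thesis
    using \<pi> by simp
qed

lemma geodesic_dist_eq_0_iff: "geodesic_dist G w0 w1 = 0 \<longleftrightarrow> (w0, w1) \<in> fibre_rel"
proof
  assume "(w0, w1) \<in> fibre_rel"
  then obtain \<gamma> :: "real \<Rightarrow> real^'d" where "\<gamma> piecewise_differentiable_on {0..1}" "\<gamma> 0 = w0" "\<gamma> 1 = w1"
    "\<forall>t\<in>{0..1}. F (\<gamma> t) = F w0"
    unfolding reparam_rel_def by auto
  then show "geodesic_dist G w0 w1 = 0"
    using geodesic_dist_fibre_path[of \<gamma>] by simp
qed (rule fibre_rel_if_geodesic_dist_zero)

end

section \<open>Stacking over the training set\<close>

definition block :: "'n::finite \<Rightarrow> real^('n \<times> 'o::finite) \<Rightarrow> real^'o" where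
  "block n z = (\<chi> k. z $ (n, k))"

definition stacked_output ::
    "(real^'d \<Rightarrow> real^'i \<Rightarrow> real^'o) \<Rightarrow> ('n::finite \<Rightarrow> real^'i) \<Rightarrow> real^'d \<Rightarrow> real^('n \<times> 'o)" where
  "stacked_output f xs w = (\<chi> r. f w (xs (fst r)) $ snd r)"

text \<open>The stacked Hessian as a function of an arbitrary stacked output, attained by the
  network or not, which is the form of \<open>Q\<close> in \<open>pullback_geometry\<close>.\<close>

definition block_diagonal ::
    "(real^'o \<Rightarrow> real^'o^'o) \<Rightarrow> real^('n::finite \<times> 'o) \<Rightarrow> real^('n \<times> 'o)^('n \<times> 'o)" where
  "block_diagonal H z = (\<chi> r s. if fst r = fst s then H (block (fst r) z) $ snd r $ snd s else 0)"

lemma block_stacked_output: "block n (stacked_output f xs w) = f w (xs n)"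
  by (simp add: block_def stacked_output_def vec_eq_iff)

lemma stacked_hessian_eq: "stacked_hessian H f xs w = block_diagonal H (stacked_output f xs w)"
  by (simp add: vec_eq_iff stacked_hessian_def block_diagonal_def block_stacked_output)

lemma sum_UNIV_prod:
  "(\<Sum>r\<in>UNIV. g r) = (\<Sum>n\<in>UNIV. \<Sum>k\<in>UNIV. g (n, k))"
  for g :: "'n::finite \<times> 'o::finite \<Rightarrow> 'a::comm_monoid_add"
  by (simp add: sum.cartesian_product)

lemma inner_eq_sum_block: "u \<bullet> v = (\<Sum>n\<in>UNIV. block n u \<bullet> block n v)"
  by (simp add: inner_vec_def block_def sum_UNIV_prod)

lemma block_block_diagonal_mult: "block n (block_diagonal H z *v v) = H (block n z) *v block n v"
proof -
  have "block n (block_diagonal H z *v v) $ k = (H (block n z) *v block n v) $ k" for k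
  proof -
    have "block n (block_diagonal H z *v v) $ k
        = (\<Sum>m\<in>UNIV. \<Sum>j\<in>UNIV. (if n = m then H (block n z) $ k $ j else 0) * v $ (m, j))"
      unfolding block_diagonal_def matrix_vector_mult_def sum_UNIV_prod
      by (subst block_def) (simp cong: if_cong)
    also have "\<dots> = (\<Sum>m\<in>UNIV. if n = m then \<Sum>j\<in>UNIV. H (block n z) $ k $ j * v $ (m, j) else 0)"
      by (intro sum.cong) auto
    also have "\<dots> = (H (block n z) *v block n v) $ k"
      by (simp add: matrix_vector_mult_def block_def[of n v])
    finally show ?thesis .
  qed
  then show ?thesis
    by (simp add: vec_eq_iff)
qed

text \<open>The quadratic form is a sum of nonnegative terms over the blocks, and a nonzero vector
  has a nonzero block.\<close>

lemma pos_def_block_diagonal: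
  fixes z :: "real^('n::finite \<times> 'o::finite)"
  assumes "\<And>z. pos_def (H z)"
  shows "pos_def (block_diagonal H z)"
  unfolding pos_def_def
proof (intro conjI allI impI)
  have "H z $ i $ j = H z $ j $ i" for z i j
    using assms[of z] unfolding pos_def_def by (metis transpose_def vec_lambda_beta)
  then show "transpose (block_diagonal H z) = block_diagonal H z"
    by (simp add: vec_eq_iff transpose_def block_diagonal_def)
  fix v :: "real^('n \<times> 'o)" assume "v \<noteq> 0"
  then obtain n where n: "block n v \<noteq> 0"
    by (auto simp: vec_eq_iff block_def)
  have pos: "0 < u \<bullet> (H z *v u)" if "u \<noteq> 0" for u z
    using assms[of z] that by (simp add: pos_def_def)
  then have "0 \<le> u \<bullet> (H z *v u)" for u z
    by (cases "u = 0") (auto intro: less_imp_le)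
  then have "0 < (\<Sum>n\<in>UNIV. block n v \<bullet> (H (block n z) *v block n v))"
    using pos[OF n] by (intro sum_pos2[where i = n]) auto
  then show "0 < v \<bullet> (block_diagonal H z *v v)"
    by (simp add: inner_eq_sum_block block_block_diagonal_mult)
qed

lemma continuous_on_block_diagonal:
  assumes "continuous_on UNIV H"
  shows "continuous_on UNIV (block_diagonal H)"
proof -
  have c: "continuous_on UNIV (\<lambda>z. H (block n z))" for n
    unfolding block_def
    by (intro continuous_on_compose2[OF assms] continuous_on_vec_lambda continuous_on_component continuous_intros) auto
  have "continuous_on UNIV (\<lambda>z. if fst r = fst s then H (block (fst r) z) $ snd r $ snd s else 0)" for r s
    by (cases "fst r = fst s") (simp_all add: continuous_on_component c)
  then show ?thesis
    unfolding block_diagonal_def by (intro continuous_on_vec_lambda)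
qed

lemma stacked_jacobian_mult: "(stacked_jacobian f xs w *v h) $ r = (param_jacobian f w (xs (fst r)) *v h) $ snd r"
  by (simp add: stacked_jacobian_def matrix_vector_mult_def)

lemma stacked_output_has_derivative:
  assumes "\<And>x. (\<lambda>w. f w x) differentiable (at w)"
  shows "(stacked_output f xs has_derivative (\<lambda>h. stacked_jacobian f xs w *v h)) (at w)"
proof -
  have "((\<lambda>w. stacked_output f xs w $ r) has_derivative (\<lambda>h. (stacked_jacobian f xs w *v h) $ r)) (at w)" for r
  proof -
    have "((\<lambda>w. f w (xs (fst r))) has_derivative (\<lambda>h. param_jacobian f w (xs (fst r)) *v h)) (at w)"
      using assms unfolding param_jacobian_def by (simp add: jacobian_works)
    from bounded_linear.has_derivative[OF bounded_linear_vec_nth this]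
    show ?thesis
      by (simp add: stacked_output_def stacked_jacobian_mult)
  qed
  then show ?thesis
    by (subst has_derivative_componentwise_within) (auto simp: Basis_vec_def inner_axis)
qed

lemma continuous_on_stacked_jacobian:
  assumes "\<And>x. continuous_on UNIV (\<lambda>w. param_jacobian f w x)"
  shows "continuous_on UNIV (stacked_jacobian f xs)"
  unfolding stacked_jacobian_def[abs_def]
  by (intro continuous_on_vec_lambda continuous_on_component assms)

text \<open>Turns one Lipschitz constant per training point, for the Euclidean norm of matrices,
  into a single bound on the action on vectors: Cauchy-Schwarz in each row, then a sum over the
  finitely many rows.\<close>

lemma stacked_jacobian_lipschitz:
  fixes f :: "real^'d \<Rightarrow> real^'i \<Rightarrow> real^'o" and xs :: "'n::finite \<Rightarrow> real^'i"
  assumes "\<And>x. x \<in> range xs \<Longrightarrow> \<exists>C. C-lipschitz_on UNIV (\<lambda>w. param_jacobian f w x)"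
  obtains C where "0 < C"
    "\<And>u w h. norm (stacked_jacobian f xs u *v h - stacked_jacobian f xs w *v h) \<le> C * norm (u - w) * norm h"
proof -
  have "\<forall>n. \<exists>C. C-lipschitz_on UNIV (\<lambda>w. param_jacobian f w (xs n))"
    using assms by blast
  then obtain c where c: "\<And>n. (c n)-lipschitz_on UNIV (\<lambda>w. param_jacobian f w (xs n))"
    by metis
  let ?C = "\<Sum>r\<in>(UNIV :: ('n \<times> 'o) set). c (fst r)"
  have row: "\<bar>(stacked_jacobian f xs u *v h - stacked_jacobian f xs w *v h) $ r\<bar> \<le> c (fst r) * norm (u - w) * norm h"
    for u w h and r :: "'n \<times> 'o"
  proof -
    let ?D = "param_jacobian f u (xs (fst r)) - param_jacobian f w (xs (fst r))"
    have "(stacked_jacobian f xs u *v h - stacked_jacobian f xs w *v h) $ r = (?D *v h) $ snd r"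
      by (simp add: stacked_jacobian_mult matrix_vector_mult_diff_rdistrib)
    also have "\<dots> = (?D $ snd r) \<bullet> h"
      by (rule matrix_vector_mul_component)
    also have "\<bar>\<dots>\<bar> \<le> norm (?D $ snd r) * norm h"
      by (rule Cauchy_Schwarz_ineq2)
    also have "\<dots> \<le> norm ?D * norm h"
      by (intro mult_right_mono Finite_Cartesian_Product.norm_nth_le norm_ge_zero)
    also have "\<dots> \<le> c (fst r) * norm (u - w) * norm h"
      using lipschitz_onD[OF c] by (intro mult_right_mono) (simp_all add: dist_norm)
    finally show ?thesis .
  qed
  have c0: "0 \<le> ?C"
    using lipschitz_on_nonneg[OF c] by (intro sum_nonneg) auto
  show ?thesis
  proof (rule that)
    show "0 < ?C + 1"
      using c0 by simp
    fix u w h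
    have "norm (stacked_jacobian f xs u *v h - stacked_jacobian f xs w *v h)
        \<le> (\<Sum>r\<in>UNIV. \<bar>(stacked_jacobian f xs u *v h - stacked_jacobian f xs w *v h) $ r\<bar>)"
      by (rule norm_le_l1_cart)
    also have "\<dots> \<le> (\<Sum>r\<in>(UNIV :: ('n \<times> 'o) set). c (fst r) * norm (u - w) * norm h)"
      by (intro sum_mono row)
    also have "\<dots> = ?C * (norm (u - w) * norm h)"
      by (simp only: sum_distrib_right mult.assoc)
    also have "\<dots> \<le> (?C + 1) * (norm (u - w) * norm h)"
      by (intro mult_right_mono) auto
    finally show "norm (stacked_jacobian f xs u *v h - stacked_jacobian f xs w *v h) \<le> (?C + 1) * norm (u - w) * norm h"
      by (simp only: mult.assoc)
  qed
qed

text \<open>A path preserves all outputs on the training set exactly when it stays in a fibre of the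
  stacked output.\<close>

lemma reparam_rel_eq_fibres:
  fixes f :: "real^'d \<Rightarrow> real^'i \<Rightarrow> real^'o" and xs :: "'n::finite \<Rightarrow> real^'i"
  shows "reparam_rel f (range xs) = reparam_rel (\<lambda>w (_::real^1). stacked_output f xs w) UNIV"
proof -
  have "stacked_output f xs u = stacked_output f xs w \<longleftrightarrow> (\<forall>x\<in>range xs. f u x = f w x)" for u w
  proof
    assume "stacked_output f xs u = stacked_output f xs w"
    then show "\<forall>x\<in>range xs. f u x = f w x"
      by (metis block_stacked_output rangeE)
  qed (simp add: stacked_output_def)
  then show ?thesis
    by (simp add: reparam_rel_def)
qed

theorem proposition4p4:
  fixes f :: "real^'d \<Rightarrow> real^'i \<Rightarrow> real^'o"
    and xs :: "'n::finite \<Rightarrow> real^'i"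
    and M :: "'y measure"
    and p :: "'y \<Rightarrow> real^'o \<Rightarrow> real"
    and H :: "real^'o \<Rightarrow> real^'o^'o"
    and l L :: real
    and w0 w1 :: "real^'d"
  assumes f_differentiable: "\<And>w x. (\<lambda>w. f w x) differentiable (at w)"
    and f_C1: "\<And>x. continuous_on UNIV (\<lambda>w. param_jacobian f w x)"
    and likelihood: "likelihood M p"
    and log_twice_differentiable: "\<And>y. y \<in> space M \<Longrightarrow> twice_differentiable (\<lambda>z. ln (p y z))"
    and neg_log_hessian: "\<And>y z. y \<in> space M \<Longrightarrow> - hessian (\<lambda>z. ln (p y z)) z = H z"
    and H_continuous: "continuous_on UNIV H"
    and H_pos_def: "\<And>z. pos_def (H z)"
    and l_L: "0 < l" "l \<le> L"
    and NTK_bounds: "\<And>w v. v \<noteq> 0 \<Longrightarrow>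
          l \<le> norm (NTK H f xs w *v v) / norm v \<and> norm (NTK H f xs w *v v) / norm v \<le> L"
    and J_lipschitz: "\<And>x. x \<in> range xs \<Longrightarrow>
          \<exists>C. C-lipschitz_on UNIV (\<lambda>w. param_jacobian f w x)"
  shows "geodesic_dist (GGN H f xs) w0 w1 = 0 \<longleftrightarrow>
         reparam_class f (range xs) w0 = reparam_class f (range xs) w1"
proof -
  obtain C where C: "0 < C"
    "\<And>u w h. norm (stacked_jacobian f xs u *v h - stacked_jacobian f xs w *v h) \<le> C * norm (u - w) * norm h"
    by (rule stacked_jacobian_lipschitz[where f = f and xs = xs]) (rule J_lipschitz, assumption, rule that)
  have NTK_eq: "NTK H f xs w = matrix_sqrt (block_diagonal H (stacked_output f xs w)) ** stacked_jacobian f xs w **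
      transpose (stacked_jacobian f xs w) ** matrix_sqrt (block_diagonal H (stacked_output f xs w))" for w
    by (simp add: NTK_def stacked_hessian_eq)
  \<comment> \<open>Clearing the denominators extends the bounds to v = 0.\<close>
  have NTK: "l * norm v \<le> norm (NTK H f xs w *v v)" "norm (NTK H f xs w *v v) \<le> L * norm v" for w v
    using NTK_bounds[of v w] by (cases "v = 0"; simp add: pos_le_divide_eq pos_divide_le_eq)+
  interpret pullback: pullback_geometry "stacked_output f xs" "stacked_jacobian f xs" "block_diagonal H" C l L
  proof
    show "(stacked_output f xs has_derivative (\<lambda>h. stacked_jacobian f xs w *v h)) (at w)" for w
      by (rule stacked_output_has_derivative[OF f_differentiable])
    show "continuous_on UNIV (stacked_jacobian f xs)"
      by (rule continuous_on_stacked_jacobian[OF f_C1])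
  qed (use C l_L NTK[unfolded NTK_eq] in
      \<open>auto intro: continuous_on_block_diagonal[OF H_continuous] pos_def_block_diagonal[OF H_pos_def]\<close>)
  have "pullback.G = GGN H f xs"
    by (simp add: fun_eq_iff pullback.G_def GGN_def stacked_hessian_eq)
  then show ?thesis
    using pullback.geodesic_dist_eq_0_iff[of w0 w1]
      eq_equiv_class_iff[OF equiv_reparam_rel UNIV_I UNIV_I, of f "range xs" w0 w1]
    by (simp add: reparam_class_def reparam_rel_eq_fibres)
qed

end
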